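(* Let $p_1\equiv 7\pmod 8$ be a prime, $m\ge1$, $N=2p_1^m$, and let $p\equiv 3\pmod 4$ be a prime with $f:=\mathrm{ord}_N(p)=\phi(N)/2$. Let $s$ be odd, $q=p^{fs}$, and let $I\subseteq\mathbb{Z}/N\mathbb{Z}$ satisfy $\{i \bmod p_1^m: i\in I\}=\mathbb{Z}/p_1^m\mathbb{Z}$. Let $t$ be an odd positive integer; for a positive integer $n$ with base-$p$ expansion $n=\sum_{h=0}^r x_hp^h$ ($0\le x_h\le p-1$) put $e(n)=\sum_{h=0}^r x_h$, and let $t'$ be the odd integer with $1\le t'\le p-2$ obtained as $t'=e(e(\cdots e(t)\cdots))$. Let $\gamma$ and $\beta$ be primitive elements of $\mathbb{F}_{q^t}$ and $\mathbb{F}_{q^{t'}}$ respectively with $\gamma^{(q^t-1)/(q-1)}=\beta^{(q^{t'}-1)/(q-1)}=:\omega$. Let $D=\bigcup_{i\in I}\omega^i\langle\omega^N\rangle\subseteq\mathbb{F}_q$, and let $D'=\bigcup_{i\in I}\gamma^i\langle\gamma^N\rangle\subseteq \mathbb{F}_{q^t}$ and $D''=\bigcup_{i\in I}\beta^i\langle\beta^N\rangle\subseteq\mathbb{F}_{q^{t'}}$ be its lifts. Fix $a\in\mathbb{F}_p^\ast\setminus\{1\}$. If the set $\{T_{\beta^\ell,a}(D'')\bmod p: 0\le\ell\le N-1\}$ contains $u$ distinct elements, then the set $\{T_{\gamma^\ell,a}(D')\bmod p: 0\le\ell\le N-1\}$ also contains $u$ distinct elements.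
   Context: For a subset $E$ of a finite field $\mathbb{F}$ of characteristic $p$, an element $x\in\mathbb{F}^\ast$, and $a\in\mathbb{F}_p^\ast\setminus\{1\}$, the triple intersection number is $T_{x,a}(E)=|E\cap(E-x)\cap(E-ax)|$, where $E-y=\{e-y:e\in E\}$. Here $\langle\omega^N\rangle$ denotes the multiplicative subgroup generated by $\omega^N$. *)

theory Defs
  imports "HOL-Number_Theory.Number_Theory" "HOL-Library.Cardinality"
begin

definition field_embedding :: "('a::field \<Rightarrow> 'b::field) \<Rightarrow> bool" where
  "field_embedding \<iota> \<longleftrightarrow>
     \<iota> 1 = 1 \<and> (\<forall>x y. \<iota> (x + y) = \<iota> x + \<iota> y) \<and> (\<forall>x y. \<iota> (x * y) = \<iota> x * \<iota> y)"

text \<open>The cyclic multiplicative group generated by \<open>g \<noteq> 0\<close>.\<close>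

definition mult_gen :: "'a::field \<Rightarrow> 'a set" where
  "mult_gen g = range (\<lambda>k::int. g powi k)"

text \<open>The element \<open>0\<close> is never primitive, since \<open>0 powi k = 0\<close> for \<open>k \<noteq> 0\<close>.\<close>

definition primitive_element :: "'a::field \<Rightarrow> bool" where
  "primitive_element g \<longleftrightarrow> mult_gen g = UNIV - {0}"

text \<open>
  The union of the cyclotomic classes \<open>g\<^sup>i\<langle>g\<^sup>N\<rangle>\<close>, \<open>i \<in> I\<close>. A subset of \<open>\<int>/N\<int>\<close> is represented by
  the set \<open>I \<subseteq> {0..<N}\<close> of its least nonnegative residues.
\<close>

definition cyclotomic_union :: "nat \<Rightarrow> nat set \<Rightarrow> 'a::field \<Rightarrow> 'a set" where
  "cyclotomic_union N I g = (\<Union>i\<in>I. (\<lambda>y. g ^ i * y) ` mult_gen (g ^ N))"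

definition translate_by :: "'a::field set \<Rightarrow> 'a \<Rightarrow> 'a set" where
  "translate_by E y = (\<lambda>e. e - y) ` E"

definition triple_intersection :: "'a::field \<Rightarrow> 'a \<Rightarrow> 'a set \<Rightarrow> nat" where
  "triple_intersection x a E = card (E \<inter> translate_by E x \<inter> translate_by E (a * x))"

text \<open>For \<open>p \<ge> 2\<close>, the sum of the base-\<open>p\<close> digits of \<open>n\<close>; see \<open>digit_sum_expansion\<close>.\<close>

function digit_sum :: "nat \<Rightarrow> nat \<Rightarrow> nat" where
  "digit_sum p n = (if p < 2 \<or> n = 0 then 0 else n mod p + digit_sum p (n div p))"
  by auto
termination
  by (relation "measure snd") auto

declare digit_sum.simps [simp del]

lemma digit_sum_expansion:
  assumes "p \<ge> 2" and "\<And>h. h \<le> r \<Longrightarrow> x h < p" and "n = (\<Sum>h\<le>r. x h * p ^ h)"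
  shows "digit_sum p n = (\<Sum>h\<le>r. x h)"
  using assms
proof (induction r arbitrary: n x)
  case 0
  then show ?case
    by (simp add: digit_sum.simps[of p "x 0"] digit_sum.simps[of p 0])
next
  case (Suc r)
  define m where "m = (\<Sum>h\<le>r. x (Suc h) * p ^ h)"
  have n: "n = x 0 + p * m"
    by (simp add: Suc.prems(3) m_def sum.atMost_Suc_shift sum_distrib_left mult_ac del: sum.atMost_Suc)
  have x0: "x 0 < p"
    using Suc.prems(2) by simp
  have "digit_sum p n = x 0 + digit_sum p m"
  proof (cases "n = 0")
    case True
    then show ?thesis
      using n \<open>p \<ge> 2\<close> by (simp add: digit_sum.simps[of p 0])
  next
    case False
    have "n mod p = x 0" "n div p = m"
      using x0 by (simp_all add: n)
    then show ?thesis
      using False \<open>p \<ge> 2\<close> by (simp add: digit_sum.simps[of p n])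
  qed
  also have "digit_sum p m = (\<Sum>h\<le>r. x (Suc h))"
    using Suc.prems by (intro Suc.IH) (auto simp: m_def)
  finally show ?case
    by (simp add: sum.atMost_Suc_shift del: sum.atMost_Suc)
qed

end

theory Submission
  imports Defs "HOL-Computational_Algebra.Polynomial"
begin

text \<open>
  The residue of \<open>T\<close> modulo \<open>p\<close> is the same for both lifts, for every \<open>\<ell>\<close>. On nonzero elements, the
  indicator of a union of cyclotomic classes is a combination of the functions \<open>w\<^sup>i\<^sup>M\<^sup>E\<close> with
  \<open>i < N\<close>, \<open>M = (q - 1) / N\<close>, \<open>E = 1 + q + \<dots> + q\<^sup>n\<^sup>-\<^sup>1\<close> for the extension of degree \<open>n\<close>, and with
  coefficients in the base field that do not depend on \<open>n\<close>. Hence \<open>T\<close> is a combination of sums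
  \<open>\<Sum>\<^sub>z z\<^sup>i\<^sup>M\<^sup>E (z + 1)\<^sup>j\<^sup>M\<^sup>E (z + a)\<^sup>k\<^sup>M\<^sup>E\<close>. The Frobenius map shows that such a sum is unchanged when
  \<open>(i, j, k)\<close> is multiplied by \<open>p\<close> modulo \<open>N\<close>, and the hypotheses on \<open>N\<close> and \<open>p\<close> allow one to reach
  \<open>i + j + k \<le> 2 N\<close> in this way. Then \<open>G = x\<^sup>i\<^sup>M (x + 1)\<^sup>j\<^sup>M (x + a)\<^sup>k\<^sup>M\<close> has degree at most
  \<open>2 (q - 1)\<close>, so that no carries occur in base \<open>q\<close> and the coefficient of \<open>x\<close> to the power
  \<open>q\<^sup>n - 1\<close> in \<open>G\<^sup>E\<close> is the \<open>n\<close>-th power of an element of the prime field. By Fermat, this power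
  depends only on \<open>n\<close> modulo \<open>p - 1\<close>, which is preserved by taking digit sums.
\<close>

section \<open>Powers of a prime of index two modulo twice a prime power\<close>

text \<open>Gauss's lemma with \<open>r = 8 j + 7\<close>: among the doubles of
  \<open>1, ..., 4 j + 3\<close>, exactly \<open>2 j + 2\<close> exceed
  \<open>(r - 1) div 2\<close>, an even number.\<close>

lemma two_power_half_cong_1:
  fixes r :: nat
  assumes "prime r" and "[r = 7] (mod 8)"
  shows "[2 ^ ((r - 1) div 2) = 1] (mod int r)"
proof -
  have r8: "r mod 8 = 7"
    using assms(2) by (simp add: cong_def)
  obtain j where j: "r = 8 * j + 7"
    by (metis r8 mult_div_mod_eq)
  interpret GAUSS r 2
    using assms(1) j by unfold_locales (auto simp: cong_def)
  have "C = (\<lambda>x. 2 * x) ` {0<..4 * int j + 3}"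
    unfolding C_def B_def A_def image_image using j by (auto simp: image_iff)
  then have "E = (\<lambda>x. 2 * x) ` {2 * int j + 1<..4 * int j + 3}"
    unfolding E_def using j by (auto simp: image_iff)
  then have "card E = card {2 * int j + 1<..4 * int j + 3}"
    by (simp add: card_image inj_on_def)
  then have "card E = 2 * (j + 1)"
    by simp
  then have "(-1) ^ card E = (1 :: int)"
    by simp
  moreover have "nat ((int r - 1) div 2) = (r - 1) div 2"
    using j by simp
  ultimately show ?thesis
    using pre_gauss_lemma by simp
qed

section \<open>Units modulo \<open>N\<close>: the powers of \<open>p\<close> and their
  negatives\<close>

locale index_two_residues =
  fixes r m N p f :: nat
  assumes prime_r: "prime r" and r_cong_7: "[r = 7] (mod 8)"
    and m_ge_1: "m \<ge> 1" and N_eq: "N = 2 * r ^ m"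
    and f_eq: "f = ord N p" and two_f: "2 * f = totient N"
begin

lemma r_mod_8: "r mod 8 = 7"
  using r_cong_7 by (simp add: cong_def)

lemma r_ge_7: "r \<ge> 7"
  using r_mod_8 mod_less_eq_dividend[of r 8] by simp

lemma odd_r: "odd r"
  using r_mod_8 by presburger

lemma N_gt_2: "N > 2"
proof -
  have "r ^ 1 \<le> r ^ m"
    using m_ge_1 r_ge_7 by (intro power_increasing) auto
  then show ?thesis
    using N_eq r_ge_7 by simp
qed

lemma f_eq_prod: "f = r ^ (m - 1) * ((r - 1) div 2)"
proof -
  have "totient N = totient 2 * totient (r ^ m)"
    unfolding N_eq using odd_r by (intro totient_mult_coprime) auto
  also have "\<dots> = r ^ (m - 1) * (r - 1)"
    using m_ge_1 prime_r by (simp add: totient_prime_power)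
  also have "r - 1 = 2 * ((r - 1) div 2)"
    using odd_r by simp
  finally have "2 * f = 2 * (r ^ (m - 1) * ((r - 1) div 2))"
    using two_f by (simp only: mult_ac)
  then show ?thesis
    by simp
qed

lemma odd_half: "odd ((r - 1) div 2)"
  using r_mod_8 by presburger

lemma odd_f: "odd f"
  unfolding f_eq_prod using odd_half odd_r by simp

lemma f_pos: "f > 0"
  using odd_f by (rule odd_pos)

lemma coprime_N_p: "coprime N p"
  using f_pos f_eq by simp

lemma power_f: "[p ^ f = 1] (mod N)"
  unfolding f_eq by (rule ord)

lemma power_f_int: "[int p ^ f = 1] (mod int N)"
  using power_f by (metis cong_int_iff of_nat_1 of_nat_power)

text \<open>\<open>f\<close> is odd, so \<open>- 1\<close> is its own \<open>f\<close>-th power,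
  whereas every power of \<open>p\<close> has \<open>f\<close>-th power \<open>1\<close>.\<close>

lemma not_cong_minus_power: "\<not> [- 1 = int p ^ d] (mod int N)"
proof
  assume A: "[- 1 = int p ^ d] (mod int N)"
  then have "[(- 1) ^ f = (int p ^ d) ^ f] (mod int N)"
    by (rule cong_pow)
  also have "(int p ^ d) ^ f = (int p ^ f) ^ d"
    by (simp add: power_mult[symmetric] mult.commute)
  also have "[(int p ^ f) ^ d = 1 ^ d] (mod int N)"
    by (rule cong_pow[OF power_f_int])
  finally have "[- 1 = 1] (mod int N)"
    using odd_f by simp
  then have "int N dvd 2"
    by (simp add: cong_iff_dvd_diff)
  then show False
    using N_gt_2 zdvd_imp_le by force
qed

lemma power_cong_iff: "[int p ^ c = int p ^ d] (mod int N) \<longleftrightarrow> [c = d] (mod f)"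
proof -
  have "[int p ^ c = int p ^ d] (mod int N) \<longleftrightarrow> [p ^ c = p ^ d] (mod N)"
    by (metis cong_int_iff of_nat_power)
  also have "\<dots> \<longleftrightarrow> [c = d] (mod f)"
    unfolding f_eq using coprime_N_p by (intro order_divides_expdiff) auto
  finally show ?thesis .
qed

text \<open>The \<open>f\<close> powers of \<open>p\<close> and their negatives are disjoint,
  because \<open>- 1\<close> is not a power of \<open>p\<close>; together they fill all
  \<open>totient N = 2 f\<close> units.\<close>

lemma coprime_cases:
  assumes "coprime u (int N)"
  obtains d where "[u = int p ^ d] (mod int N)" | d where "[u = - (int p ^ d)] (mod int N)"
proof -
  define A where "A = (\<lambda>d. int p ^ d mod int N) ` {..<f}"
  define B where "B = (\<lambda>d. (- (int p ^ d)) mod int N) ` {..<f}"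
  define T where "T = int ` totatives N"
  have card_T: "card T = 2 * f"
    unfolding T_def by (simp add: card_image totient_def two_f)
  have in_T: "x mod int N \<in> T" if "coprime x (int N)" for x
  proof -
    have "x mod int N \<noteq> 0"
    proof
      assume "x mod int N = 0"
      then have "int N dvd x" by auto
      then have "is_unit (int N)"
        using that by (meson coprime_common_divisor dvd_refl)
      then show False using N_gt_2 by simp
    qed
    moreover have "0 \<le> x mod int N" "x mod int N < int N"
      using N_gt_2 by simp_all
    moreover have "coprime (x mod int N) (int N)"
      using that N_gt_2 by (simp add: coprime_mod_left_iff)
    ultimately have "nat (x mod int N) \<in> totatives N"
      by (auto simp: in_totatives_iff coprime_int_iff[symmetric])
    then show ?thesis
      unfolding T_def using \<open>0 \<le> x mod int N\<close> by (metis imageI int_nat_eq)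
  qed
  have cp: "coprime (int p ^ d) (int N)" for d
    using coprime_N_p by (simp add: coprime_commute)
  have "A \<subseteq> T" "B \<subseteq> T"
    unfolding A_def B_def using in_T cp by (auto intro: in_T)
  have "inj_on (\<lambda>d. int p ^ d mod int N) {..<f}"
    using power_cong_iff by (auto simp: inj_on_def cong_def)
  then have cA: "card A = f"
    unfolding A_def by (simp add: card_image)
  have "inj_on (\<lambda>d. (- (int p ^ d)) mod int N) {..<f}"
  proof (rule inj_onI)
    fix c d assume cd: "c \<in> {..<f}" "d \<in> {..<f}"
      and "(- (int p ^ c)) mod int N = (- (int p ^ d)) mod int N"
    then have "[int p ^ c = int p ^ d] (mod int N)"
      by (simp add: cong_def[symmetric] cong_minus_minus_iff)
    then show "c = d"
      using cd by (simp add: power_cong_iff) (simp add: cong_def)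
  qed
  then have cB: "card B = f"
    unfolding B_def by (simp add: card_image)
  have disj: "A \<inter> B = {}"
  proof (rule ccontr)
    assume "A \<inter> B \<noteq> {}"
    then obtain c d where c: "c < f" and "[int p ^ c = - (int p ^ d)] (mod int N)"
      unfolding A_def B_def by (auto simp: cong_def)
    \<comment> \<open>Multiplying by \<open>p ^ (f - c)\<close> turns the left-hand side into
      \<open>1\<close> and so exhibits \<open>- 1\<close> as a power of \<open>p\<close>.\<close>
    then have "[int p ^ (f - c) * int p ^ c = int p ^ (f - c) * - (int p ^ d)] (mod int N)"
      by (intro cong_mult) auto
    moreover have "int p ^ (f - c) * int p ^ c = int p ^ f"
      using c by (simp add: power_add[symmetric])
    ultimately have "[int p ^ f = - (int p ^ (f - c + d))] (mod int N)"
      by (simp add: power_add)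
    then have "[1 = - (int p ^ (f - c + d))] (mod int N)"
      using power_f_int cong_sym cong_trans by blast
    then have "[- 1 = int p ^ (f - c + d)] (mod int N)"
      using cong_minus_minus_iff by force
    then show False
      using not_cong_minus_power by blast
  qed
  have fin: "finite A" "finite B" "finite T"
    unfolding A_def B_def T_def by auto
  have "card (A \<union> B) = card T"
    using card_Un_disjoint[OF fin(1,2) disj] cA cB card_T by simp
  then have "A \<union> B = T"
    using \<open>A \<subseteq> T\<close> \<open>B \<subseteq> T\<close> fin(3) by (intro card_subset_eq) auto
  then have "u mod int N \<in> A \<union> B"
    using in_T[OF assms] by simp
  then show thesis
    using that unfolding A_def B_def by (auto simp: cong_def)
qed

lemma power_half: "[int p ^ ((r - 1) div 2) = 1] (mod int r)"
proof -
  have rp: "[x ^ (r ^ n) = x] (mod r)" for x n :: nat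
  proof (induction n)
    case (Suc n)
    have "[x ^ r = x] (mod r)"
    proof (cases "r dvd x")
      case True
      then have "r dvd x ^ r"
        using r_ge_7 by (simp add: dvd_power_iff prime_r prime_dvd_power_iff)
      with True show ?thesis
        by (simp add: cong_def)
    next
      case False
      then have "[x ^ (r - 1) * x = 1 * x] (mod r)"
        by (intro cong_mult fermat_theorem prime_r) auto
      then show ?thesis
        using r_ge_7 by (metis One_nat_def Suc_pred' mult_1 not_numeral_le_zero neq0_conv power_Suc2)
    qed
    have "x ^ r ^ Suc n = (x ^ r ^ n) ^ r"
      by (simp add: power_mult[symmetric] mult.commute)
    also have "[\<dots> = x ^ r] (mod r)"
      by (rule cong_pow[OF Suc.IH])
    also note \<open>[x ^ r = x] (mod r)\<close>
    finally show ?case .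
  qed simp
  have "r dvd N"
    unfolding N_eq using m_ge_1 by (simp add: dvd_power)
  then have "[p ^ f = 1] (mod r)"
    using power_f cong_dvd_modulus_nat by blast
  moreover have "[p ^ f = p ^ ((r - 1) div 2)] (mod r)"
    using rp[of "p ^ ((r - 1) div 2)" "m - 1"]
    by (simp add: f_eq_prod power_mult[symmetric] mult.commute)
  ultimately have "[p ^ ((r - 1) div 2) = 1] (mod r)"
    by (meson cong_sym cong_trans)
  then show ?thesis
    by (metis cong_int_iff of_nat_1 of_nat_power)
qed

text \<open>The power \<open>(r - 1) div 2\<close> modulo \<open>r\<close> is the quadratic
  character. It ignores powers of \<open>p\<close> and sends \<open>- 1\<close> to
  \<open>- 1\<close>, so it tells \<open>\<langle>p\<rangle>\<close> and
  \<open>- \<langle>p\<rangle>\<close> apart.\<close>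

lemma half_power_of_cong:
  assumes "[u = c * int p ^ d] (mod int N)"
  shows "[u ^ ((r - 1) div 2) = c ^ ((r - 1) div 2)] (mod int r)"
proof -
  let ?h = "(r - 1) div 2"
  have "int r dvd int N"
    unfolding N_eq using m_ge_1 by (simp add: dvd_power)
  then have "[u = c * int p ^ d] (mod int r)"
    using assms cong_dvd_modulus by blast
  then have "[u ^ ?h = (c * int p ^ d) ^ ?h] (mod int r)"
    by (rule cong_pow)
  also have "(c * int p ^ d) ^ ?h = c ^ ?h * (int p ^ ?h) ^ d"
    by (simp add: power_mult_distrib power_mult[symmetric] mult.commute)
  also have "[\<dots> = c ^ ?h * 1 ^ d] (mod int r)"
    by (intro cong_mult cong_pow power_half cong_refl)
  finally show ?thesis
    by simp
qed

lemma not_minus_1_cong_1: "\<not> [- 1 = 1] (mod int r)"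
proof
  assume "[- 1 = 1] (mod int r)"
  then have "int r dvd 2"
    by (simp add: cong_iff_dvd_diff)
  then show False
    using r_ge_7 zdvd_imp_le by force
qed

lemma coprime_N_iff: "coprime u (int N) \<longleftrightarrow> odd u \<and> \<not> int r dvd u"
proof -
  have "coprime u (int r) \<longleftrightarrow> \<not> int r dvd u"
    using prime_r
    by (metis coprime_commute coprime_common_divisor dvd_refl not_prime_unit prime_imp_coprime
        prime_nat_int_transfer)
  then show ?thesis
    unfolding N_eq using m_ge_1 by (auto simp: coprime_power_right_iff)
qed

text \<open>As \<open>2\<close> is not a unit modulo the even \<open>N\<close>,
  \<open>r ^ m + 2\<close> takes its place as a multiplier that doubles. It is odd and congruent
  modulo \<open>r\<close> to the square \<open>2\<close>, which excludes
  \<open>- \<langle>p\<rangle>\<close>.\<close>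

lemma r_power_plus_2: obtains d where "[int (r ^ m) + 2 = int p ^ d] (mod int N)"
proof -
  let ?h = "(r - 1) div 2"
  have dvd: "int r dvd int (r ^ m)"
    using m_ge_1 by (simp add: dvd_power)
  have "coprime (int (r ^ m) + 2) (int N)"
  proof -
    have "\<not> int r dvd 2"
      using r_ge_7 zdvd_imp_le by force
    then have "\<not> int r dvd int (r ^ m) + 2"
      using dvd dvd_add_right_iff by blast
    then show ?thesis
      using odd_r by (simp add: coprime_N_iff)
  qed
  then show thesis
  proof (cases rule: coprime_cases)
    case (2 d)
    then have "[(int (r ^ m) + 2) ^ ?h = (- 1) ^ ?h] (mod int r)"
      using half_power_of_cong[of "int (r ^ m) + 2" "- 1" d] by simp
    moreover have "[int (r ^ m) + 2 = 2] (mod int r)"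
      using dvd by (simp add: cong_iff_dvd_diff)
    then have "[(int (r ^ m) + 2) ^ ?h = 2 ^ ?h] (mod int r)"
      by (rule cong_pow)
    moreover have "[2 ^ ?h = 1] (mod int r)"
      by (rule two_power_half_cong_1[OF prime_r r_cong_7])
    ultimately have "[- 1 = 1] (mod int r)"
      using odd_half by simp (meson cong_sym cong_trans)
    then show ?thesis
      using not_minus_1_cong_1 by blast
  qed (use that in blast)
qed

text \<open>\<open>- 2\<close> is a non-square modulo \<open>r\<close> because
  \<open>(r - 1) div 2\<close> is odd. This supplies an odd number below \<open>r\<close> in
  \<open>- \<langle>p\<rangle>\<close>.\<close>

lemma r_minus_2: obtains d where "[int r - 2 = - (int p ^ d)] (mod int N)"
proof -
  let ?h = "(r - 1) div 2"
  have "coprime (int r - 2) (int N)"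
  proof -
    have "\<not> int r dvd int r - 2"
      using r_ge_7 zdvd_imp_le by force
    then show ?thesis
      using odd_r by (simp add: coprime_N_iff)
  qed
  then show thesis
  proof (cases rule: coprime_cases)
    case (1 d)
    then have "[(int r - 2) ^ ?h = 1 ^ ?h] (mod int r)"
      using half_power_of_cong[of "int r - 2" 1 d] by simp
    moreover have "[int r - 2 = - 2] (mod int r)"
      by (simp add: cong_iff_dvd_diff)
    then have "[(int r - 2) ^ ?h = (- 2) ^ ?h] (mod int r)"
      by (rule cong_pow)
    moreover have "(- 2) ^ ?h = - ((2 :: int) ^ ?h)"
      using odd_half by simp
    moreover have "[- (2 ^ ?h) = - 1] (mod int r)"
      using two_power_half_cong_1[OF prime_r r_cong_7] cong_minus_minus_iff by blast
    ultimately have "[- 1 = 1] (mod int r)"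
      by simp (meson cong_sym cong_trans)
    then show ?thesis
      using not_minus_1_cong_1 by blast
  qed (use that in blast)
qed

section \<open>Residue sums under multiplication by powers of \<open>p\<close>\<close>

lemma power_mult_not_dvd: "\<not> int N dvd y \<Longrightarrow> \<not> int N dvd int p ^ d * y"
  using coprime_N_p by (simp add: coprime_dvd_mult_right_iff)

lemma sum_mod_cong:
  assumes "\<And>d. (\<Sum>e\<in>S. int p ^ d * y e mod int N) = int N"
    and "[u = int p ^ d] (mod int N)"
  shows "(\<Sum>e\<in>S. u * y e mod int N) = int N"
proof -
  have "u * y e mod int N = int p ^ d * y e mod int N" for e
    using cong_mult[OF assms(2) cong_refl, of "y e"] by (simp add: cong_def)
  then show ?thesis
    using assms(1)[of d] by simp
qed

text \<open>Negation replaces each nonzero residue by its complement to \<open>N\<close>, so the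
  total \<open>N\<close> becomes \<open>card S * N - N\<close>.\<close>

lemma sum_mod_cong_minus:
  assumes "\<And>d. (\<Sum>e\<in>S. int p ^ d * y e mod int N) = int N"
    and "[u = - (int p ^ d)] (mod int N)" and "\<And>e. e \<in> S \<Longrightarrow> \<not> int N dvd y e"
  shows "(\<Sum>e\<in>S. u * y e mod int N) = (int (card S) - 1) * int N"
proof -
  have "u * y e mod int N = int N - int p ^ d * y e mod int N" if "e \<in> S" for e
  proof -
    have "u * y e mod int N = (- (int p ^ d * y e)) mod int N"
      using cong_mult[OF assms(2) cong_refl, of "y e"] by (simp add: cong_def)
    also have "\<dots> = int N - int p ^ d * y e mod int N"
      using power_mult_not_dvd[OF assms(3)[OF that]] by (auto simp: zmod_zminus1_eq_if)
    finally show ?thesis .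
  qed
  then have "(\<Sum>e\<in>S. u * y e mod int N) = (\<Sum>e\<in>S. int N - int p ^ d * y e mod int N)"
    by (intro sum.cong) auto
  then show ?thesis
    using assms(1)[of d] by (simp add: sum_subtractf algebra_simps)
qed

text \<open>
  Let \<open>g\<close> be the least odd positive integer with \<open>- g \<in> \<langle>p\<rangle>\<close>; then \<open>g - 2 \<in> \<langle>p\<rangle>\<close>. Multiplying
  the residues by \<open>g - 2\<close> and by \<open>g\<close> gives the sums \<open>N\<close> and \<open>3 N\<close>, which leaves no room for a
  wrap-around when \<open>2 y\<close> is added to \<open>(g - 2) y\<close>.
\<close>

lemma residue_less_half:
  assumes sums: "\<And>d. (\<Sum>e\<in>S. int p ^ d * y e mod int N) = int N"
    and nz: "\<And>e. e \<in> S \<Longrightarrow> \<not> int N dvd y e" and S: "card S = 4" and e: "e \<in> S"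
  shows "2 * (y e mod int N) < int N"
proof -
  define P where "P g \<longleftrightarrow> odd g \<and> (\<exists>d. [int g = - (int p ^ d)] (mod int N))" for g :: nat
  obtain d0 where "[int r - 2 = - (int p ^ d0)] (mod int N)"
    by (rule r_minus_2)
  then have "P (r - 2)"
    unfolding P_def using odd_r r_ge_7 by (auto simp: of_nat_diff)
  define g where "g = (LEAST g. P g)"
  have Pg: "P g"
    unfolding g_def using \<open>P (r - 2)\<close> by (rule LeastI)
  have "g \<le> r - 2"
    unfolding g_def using \<open>P (r - 2)\<close> by (rule Least_le)
  obtain d where d: "[int g = - (int p ^ d)] (mod int N)" and "odd g"
    using Pg unfolding P_def by blast
  have "g \<noteq> 1"
  proof
    assume "g = 1"
    then have "[- (- 1) = - (int p ^ d)] (mod int N)"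
      using d by simp
    then show False
      using not_cong_minus_power cong_minus_minus_iff by blast
  qed
  with \<open>odd g\<close> have "g \<ge> 3"
    by presburger
  define a where "a = int g - 2"
  have "coprime a (int N)"
  proof -
    have "\<not> int r dvd a"
      using \<open>g \<ge> 3\<close> \<open>g \<le> r - 2\<close> zdvd_imp_le[of "int r" a] unfolding a_def by force
    then show ?thesis
      using \<open>odd g\<close> unfolding a_def by (simp add: coprime_N_iff)
  qed
  then have sum_a: "(\<Sum>e\<in>S. a * y e mod int N) = int N"
  proof (cases rule: coprime_cases)
    case (1 c)
    show ?thesis
      by (rule sum_mod_cong[OF sums 1])
  next
    \<comment> \<open>Here \<open>g - 2\<close> would be a smaller odd number with the property that
      defines \<open>g\<close>.\<close>
    case (2 c)
    then have "P (g - 2)"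
      unfolding P_def a_def using \<open>odd g\<close> \<open>g \<ge> 3\<close> by (auto simp: of_nat_diff)
    then have "g \<le> g - 2"
      unfolding g_def by (rule Least_le)
    then show ?thesis
      using \<open>g \<ge> 3\<close> by simp
  qed
  have le: "int g * y i mod int N \<le> a * y i mod int N + 2 * (y i mod int N)" for i
  proof -
    have "int g * y i = a * y i + 2 * y i"
      unfolding a_def by (simp add: algebra_simps)
    then have "int g * y i mod int N = (a * y i mod int N + 2 * (y i mod int N)) mod int N"
      by (metis mod_add_eq mod_mult_right_eq mod_mod_trivial)
    also have "\<dots> \<le> a * y i mod int N + 2 * (y i mod int N)"
      using N_gt_2 by (intro zmod_le_nonneg_dividend add_nonneg_nonneg mult_nonneg_nonneg) auto
    finally show ?thesis .
  qed
  \<comment> \<open>Both sides of the termwise bound \<open>le\<close> have total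
    \<open>3 N\<close>, so equality holds in each term.\<close>
  have "(\<Sum>i\<in>S. int g * y i mod int N) = 3 * int N"
    using sum_mod_cong_minus[OF sums d nz] S by simp
  also have "\<dots> = (\<Sum>i\<in>S. a * y i mod int N + 2 * (y i mod int N))"
    using sum_a sums[of 0] by (simp add: sum.distrib sum_distrib_left[symmetric])
  finally have "int g * y e mod int N = a * y e mod int N + 2 * (y e mod int N)"
    using le by (rule sum_mono_inv[OF _ _ e]) (use S card_ge_0_finite[of S] in simp)
  moreover have "int g * y e mod int N < int N" "0 \<le> a * y e mod int N"
    using N_gt_2 by simp_all
  moreover have "2 * w < n" if "u = v + 2 * w" "u < n" "0 \<le> v" for u v w n :: int
    using that by simp
  ultimately show ?thesis
    by blast
qed

text \<open>All residues stay below \<open>N / 2\<close>. Multiplication by \<open>r ^ m + 2\<close>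
  doubles an even residue, and sends an odd one to its double plus \<open>N / 2\<close>, which
  forces odd residues above \<open>N / 4\<close>. Four of those would exceed the total
  \<open>N\<close>, so some residue is even; it can then be doubled forever.\<close>

lemma no_four_residues:
  assumes sums: "\<And>d. (\<Sum>e\<in>S. int p ^ d * y e mod int N) = int N"
    and nz: "\<And>e. e \<in> S \<Longrightarrow> \<not> int N dvd y e" and S: "card S = 4"
  shows False
proof -
  define Y where "Y d e = int p ^ d * y e mod int N" for d e
  have half: "2 * Y d e < int N" if "e \<in> S" for d e
    unfolding Y_def
  proof (rule residue_less_half[where S = S and y = "\<lambda>e. int p ^ d * y e", OF _ _ S that])
    show "(\<Sum>e\<in>S. int p ^ d' * (int p ^ d * y e) mod int N) = int N" for d'
      using sums[of "d' + d"] by (simp add: power_add mult.assoc)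
  qed (use nz power_mult_not_dvd in blast)
  have pos: "0 < Y d e" if "e \<in> S" for d e
    using power_mult_not_dvd[OF nz[OF that]] N_gt_2 unfolding Y_def
    by (metis dvd_eq_mod_eq_0 of_nat_0_less_iff order_le_less pos_mod_sign zero_less_numeral
        less_trans)
  obtain c where c: "[int (r ^ m) + 2 = int p ^ c] (mod int N)"
    by (rule r_power_plus_2)
  have step: "Y (c + d) e = (int (r ^ m) * Y d e + 2 * Y d e) mod int N" for d e
  proof -
    have "Y (c + d) e = int p ^ c * (int p ^ d * y e) mod int N"
      unfolding Y_def by (simp add: power_add mult.assoc)
    also have "\<dots> = (int (r ^ m) + 2) * (int p ^ d * y e) mod int N"
      using cong_mult[OF c cong_refl, of "int p ^ d * y e"] by (simp add: cong_def)
    also have "\<dots> = (int (r ^ m) + 2) * Y d e mod int N"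
      unfolding Y_def by (simp add: mod_mult_right_eq)
    finally show ?thesis
      by (simp add: algebra_simps)
  qed
  have N': "int N = 2 * int (r ^ m)"
    unfolding N_eq by simp
  have double: "Y (c + d) e = 2 * Y d e" if "e \<in> S" and ev: "even (Y d e)" for d e
  proof -
    obtain w where w: "Y d e = 2 * w"
      using ev by blast
    have "Y (c + d) e = (2 * Y d e + int N * w) mod int N"
      unfolding step N' by (simp add: w mult_ac add_ac)
    also have "\<dots> = 2 * Y d e"
      using half[OF that(1), of d] pos[OF that(1), of d] by simp
    finally show ?thesis .
  qed
  have odd_large: "4 * Y 0 e > int N" if "e \<in> S" and od: "odd (Y 0 e)" for e
  proof (rule ccontr)
    assume "\<not> 4 * Y 0 e > int N"
    obtain w where w: "Y 0 e = 2 * w + 1"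
      using od by (rule oddE)
    \<comment> \<open>Parity excludes the boundary case \<open>4 * Y 0 e = N\<close>.\<close>
    have "odd (int (r ^ m))"
      using odd_r by simp
    then have "2 * Y 0 e \<noteq> int (r ^ m)"
      by (metis dvd_triv_left)
    then have lt: "int (r ^ m) + 2 * Y 0 e < int N"
      using \<open>\<not> 4 * Y 0 e > int N\<close> N' by linarith
    have "Y (c + 0) e = (int (r ^ m) + 2 * Y 0 e + int N * w) mod int N"
      unfolding step N' by (simp add: w algebra_simps)
    also have "\<dots> = int (r ^ m) + 2 * Y 0 e"
      using lt pos[OF that(1), of 0] by simp
    finally show False
      using half[OF that(1), of "c + 0"] pos[OF that(1), of 0] N' by linarith
  qed
  obtain e where e: "e \<in> S" "even (Y 0 e)"
  proof (rule ccontr)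
    assume "\<not> thesis"
    then have "\<And>e. e \<in> S \<Longrightarrow> 4 * Y 0 e > int N"
      using odd_large that by blast
    then have "(\<Sum>e\<in>S. int N) < (\<Sum>e\<in>S. 4 * Y 0 e)"
      using S card_ge_0_finite[of S] by (intro sum_strict_mono) auto
    moreover have "(\<Sum>e\<in>S. Y 0 e) = int N"
      using sums[of 0] unfolding Y_def by simp
    ultimately show False
      using S by (simp add: sum_distrib_left[symmetric])
  qed
  have "\<exists>d. Y d e = 2 ^ n * Y 0 e" for n
  proof (induction n)
    case 0
    show ?case
      by (rule exI[of _ 0]) simp
  next
    case (Suc n)
    then obtain d where d: "Y d e = 2 ^ n * Y 0 e"
      by blast
    then have "Y (c + d) e = 2 * Y d e"
      using e by (intro double) auto
    then show ?case
      using d by (intro exI[of _ "c + d"]) simp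
  qed
  then obtain d where d: "Y d e = 2 ^ N * Y 0 e"
    by blast
  have "int N < 2 ^ N"
    by (metis of_nat_less_numeral_power_cancel_iff less_exp)
  moreover have "2 ^ N \<le> 2 ^ N * Y 0 e"
    using pos[OF e(1), of 0] by simp
  moreover have "2 ^ N * Y 0 e < int N"
    using half[OF e(1), of d] pos[OF e(1), of d] d by linarith
  ultimately show False
    by linarith
qed

text \<open>
  If every \<open>p\<close>-multiple of \<open>(i, j, k)\<close> had residue sum larger than \<open>2 N\<close>, then the residues of
  \<open>- i, - j, - k, i + j + k\<close> would have sum \<open>N\<close> after multiplication by any power of \<open>p\<close>.
\<close>

lemma exists_small_rotation:
  assumes "i < N" "j < N" "k < N"
  obtains d where "p ^ d * i mod N + p ^ d * j mod N + p ^ d * k mod N \<le> 2 * N"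
proof (rule ccontr)
  assume "\<not> thesis"
  then have large: "p ^ d * i mod N + p ^ d * j mod N + p ^ d * k mod N > 2 * N" for d
    using that not_le by blast
  \<comment> \<open>The four numbers are indexed by \<open>0, ..., 3\<close> instead of being
    collected in a set, so that equal ones are counted separately.\<close>
  define y where "y e = (if e = 0 then - int i else if e = 1 then - int j
    else if e = 2 then - int k else int i + int j + int k)" for e :: nat
  have large': "int p ^ d * int i mod int N + int p ^ d * int j mod int N
      + int p ^ d * int k mod int N > 2 * int N" for d
  proof -
    have "int (2 * N) < int (p ^ d * i mod N + p ^ d * j mod N + p ^ d * k mod N)"
      using large[of d] by (simp only: of_nat_less_iff)
    then show ?thesis
      by (simp add: zmod_int)
  qed
  have lt: "int p ^ d * x mod int N < int N" for d x
    using N_gt_2 by simp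
  have neg: "int p ^ d * (- x) mod int N = int N - int p ^ d * x mod int N"
    if "int p ^ d * x mod int N > 0" for d x
    using that by (simp add: zmod_zminus1_eq_if)
  have pos: "int p ^ d * int i mod int N > 0" "int p ^ d * int j mod int N > 0"
    "int p ^ d * int k mod int N > 0" for d
    using large'[of d] lt[of d "int i"] lt[of d "int j"] lt[of d "int k"] by linarith+
  \<comment> \<open>The three residues add up to more than \<open>2 N\<close> and less than
    \<open>3 N\<close>, so reduction subtracts exactly \<open>2 N\<close>.\<close>
  have last: "int p ^ d * (int i + int j + int k) mod int N = int p ^ d * int i mod int N
      + int p ^ d * int j mod int N + int p ^ d * int k mod int N - 2 * int N" for d
  proof -
    let ?s = "int p ^ d * int i mod int N + int p ^ d * int j mod int N
      + int p ^ d * int k mod int N"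
    have "[int p ^ d * int i + int p ^ d * int j + int p ^ d * int k = ?s] (mod int N)"
      by (intro cong_add) (simp_all add: cong_def)
    then have "int p ^ d * (int i + int j + int k) mod int N = ?s mod int N"
      by (simp only: cong_def distrib_left)
    also have "\<dots> = (?s - 2 * int N) mod int N"
      by (metis minus_mod_self2 mult_2 diff_diff_eq)
    also have "\<dots> = ?s - 2 * int N"
      using large'[of d] lt[of d "int i"] lt[of d "int j"] lt[of d "int k"]
      by (intro mod_pos_pos_trivial) linarith+
    finally show ?thesis .
  qed
  show False
  proof (rule no_four_residues[where S = "{0, 1, 2, 3 :: nat}" and y = y])
    show "(\<Sum>e\<in>{0, 1, 2, 3}. int p ^ d * y e mod int N) = int N" for d
      using neg[OF pos(1)[of d]] neg[OF pos(2)[of d]] neg[OF pos(3)[of d]] last[of d]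
      by (simp add: y_def)
    have "\<not> int N dvd int i" "\<not> int N dvd int j" "\<not> int N dvd int k"
      using pos[of 0] by auto
    moreover have "(int i + int j + int k) mod int N > 0"
      using last[of 0] large'[of 0] by simp
    then have "\<not> int N dvd int i + int j + int k"
      by auto
    ultimately show "\<not> int N dvd y e" for e
      by (simp add: y_def)
  qed simp
qed

end

section \<open>Digit sums and exponents modulo a prime\<close>

text \<open>Since \<open>p\<close> is \<open>1\<close> modulo \<open>p - 1\<close>, every digit
  counts as much as its place value.\<close>

lemma digit_sum_cong:
  assumes "p \<ge> 2"
  shows "[digit_sum p n = n] (mod (p - 1))"
proof (induction n rule: less_induct)
  case (less n)
  show ?case
  proof (cases "n = 0")
    case False
    have "[digit_sum p n = n mod p + 1 * (n div p)] (mod (p - 1))"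
      using False assms less.IH[of "n div p"]
      by (simp add: digit_sum.simps[of p n] cong_add_lcancel_nat)
    also have "[1 = p] (mod (p - 1))"
      using assms by (simp add: cong_altdef_nat cong_sym)
    then have "[n mod p + 1 * (n div p) = n mod p + p * (n div p)] (mod (p - 1))"
      by (intro cong_add cong_mult cong_refl)
    also have "n mod p + p * (n div p) = n"
      by simp
    finally show ?thesis .
  qed (simp add: digit_sum.simps)
qed

lemma digit_sum_funpow_cong:
  assumes "p \<ge> 2"
  shows "[(digit_sum p ^^ k) n = n] (mod (p - 1))"
proof (induction k)
  case (Suc k)
  then show ?case
    using digit_sum_cong[OF assms] cong_trans by fastforce
qed simp

text \<open>Fermat handles bases prime to \<open>p\<close>; for the others, positive exponents make
  both powers vanish.\<close>

lemma power_cong_of_exponent_cong: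
  fixes a p s t :: nat
  assumes "prime p" and "[s = t] (mod (p - 1))" and "s > 0" "t > 0"
  shows "[a ^ s = a ^ t] (mod p)"
proof (cases "p dvd a")
  case True
  then have "p dvd a ^ s" "p dvd a ^ t"
    using assms by (simp_all add: prime_dvd_power_iff)
  then show ?thesis
    by (simp add: cong_def mod_eq_0_iff_dvd)
next
  case False
  have *: "[a ^ s = a ^ t] (mod p)" if st: "s \<le> t" "[s = t] (mod (p - 1))" for s t
  proof -
    obtain c where c: "t = s + c * (p - 1)"
      using st cong_le_nat[of s t "p - 1"] by (auto simp: cong_sym_eq add.commute)
    have "[a ^ s * 1 ^ c = a ^ s * (a ^ (p - 1)) ^ c] (mod p)"
      by (intro cong_mult cong_pow cong_refl cong_sym[OF fermat_theorem] assms(1) False)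
    then show ?thesis
      by (simp add: c power_add power_mult[symmetric] mult.commute)
  qed
  show ?thesis
  proof (cases "s \<le> t")
    case True
    then show ?thesis
      using * assms(2) by blast
  next
    case False
    then have "[a ^ t = a ^ s] (mod p)"
      by (intro * cong_sym[OF assms(2)]) simp
    then show ?thesis
      by (rule cong_sym)
  qed
qed

section \<open>Powers of polynomials in characteristic p\<close>

lemma repunit_nat:
  fixes q :: nat
  assumes "q \<ge> 2"
  shows "(q - 1) * (\<Sum>r<n. q ^ r) = q ^ n - 1"
proof -
  obtain k where k: "q = Suc k"
    using assms by (cases q) auto
  have *: "k * (\<Sum>r<n. Suc k ^ r) + 1 = Suc k ^ n" for n
    by (induction n) (simp_all add: algebra_simps)
  have "(q - 1) * (\<Sum>r<n. q ^ r) = k * (\<Sum>r<n. Suc k ^ r) + 1 - 1"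
    by (simp add: k)
  then show ?thesis
    by (simp only: * k)
qed

lemma CHAR_poly: "CHAR('a::comm_semiring_1 poly) = CHAR('a)"
  by (rule CHAR_eqI) (auto simp: of_nat_poly of_nat_eq_0_iff_char_dvd)

text \<open>The freshman's dream: as the coefficients are fixed by the \<open>q\<close>-th power,
  \<open>P ^ q\<close> is \<open>P\<close> evaluated at \<open>x ^ q\<close>.\<close>

lemma coeff_power_CHAR:
  fixes P :: "'a::comm_semiring_1 poly"
  assumes "prime CHAR('a)" and q: "q = CHAR('a) ^ e" and fix_q: "\<And>i. coeff P i ^ q = coeff P i"
  shows "coeff (P ^ q) i = (if q dvd i then coeff P (i div q) else 0)"
proof -
  have q0: "q > 0"
    using assms by (simp add: prime_gt_0_nat)
  have "P ^ q = (\<Sum>j\<le>degree P. monom (coeff P j) j) ^ q"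
    by (simp add: poly_as_sum_of_monoms)
  also have "\<dots> = (\<Sum>j\<le>degree P. monom (coeff P j) j ^ q)"
    using assms(1) q by (intro freshmans_dream_sum') (simp_all add: CHAR_poly)
  also have "\<dots> = (\<Sum>j\<le>degree P. monom (coeff P j) (j * q))"
    by (simp add: monom_power fix_q)
  finally have *: "coeff (P ^ q) i = (\<Sum>j\<le>degree P. if j * q = i then coeff P j else 0)"
    by (simp add: coeff_sum)
  show ?thesis
  proof (cases "q dvd i")
    case True
    then obtain k where k: "i = k * q"
      by (metis dvd_div_mult_self)
    have "coeff (P ^ q) i = (\<Sum>j\<le>degree P. if j = k then coeff P j else 0)"
      unfolding * using q0 k by (intro sum.cong) auto
    also have "\<dots> = coeff P k"
      by (simp add: coeff_eq_0)
    finally show ?thesis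
      using k q0 by simp
  next
    case False
    then show ?thesis
      unfolding * by (auto intro!: sum.neutral)
  qed
qed

text \<open>No carries: \<open>R ^ q\<close> has only exponents divisible by \<open>q\<close>, so a
  contributing exponent of \<open>P\<close> is \<open>- 1\<close> modulo \<open>q\<close>. After
  \<open>q - 1\<close> the next candidate is \<open>2 q - 1\<close>, beyond the degree of
  \<open>P\<close>.\<close>

lemma coeff_mult_power_CHAR:
  fixes P R :: "'a::comm_semiring_1 poly"
  assumes "prime CHAR('a)" and q: "q = CHAR('a) ^ e" and fix_q: "\<And>i. coeff R i ^ q = coeff R i"
    and deg: "degree P \<le> 2 * (q - 1)"
  shows "coeff (P * R ^ q) (q - 1 + q * k) = coeff P (q - 1) * coeff R k"
proof -
  have q0: "q > 0"
    using assms by (simp add: prime_gt_0_nat)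
  let ?n = "q - 1 + q * k"
  have "coeff (P * R ^ q) ?n = (\<Sum>i\<le>?n. coeff P i * coeff (R ^ q) (?n - i))"
    by (rule coeff_mult)
  also have "\<dots> = (\<Sum>i\<in>{q - 1}. coeff P i * coeff (R ^ q) (?n - i))"
  proof (rule sum.mono_neutral_right)
    show "\<forall>i\<in>{..?n} - {q - 1}. coeff P i * coeff (R ^ q) (?n - i) = 0"
    proof
      fix i assume i: "i \<in> {..?n} - {q - 1}"
      show "coeff P i * coeff (R ^ q) (?n - i) = 0"
      proof (cases "q dvd ?n - i \<and> i \<le> degree P")
        case True
        then obtain j where j: "?n - i = q * j"
          by auto
        have "i + q * j = ?n"
          using i j by auto
        then have "i + 1 + q * j = q * (k + 1)"
          using q0 by simp
        then have "q dvd i + 1"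
          by (metis dvd_add_left_iff dvd_triv_left)
        then obtain l where l: "i + 1 = q * l"
          by blast
        have "i + 1 < q * 2"
          using True deg q0 by arith
        then have "q * l < q * 2"
          using l by simp
        then have "l < 2"
          by simp
        moreover have "l \<noteq> 0"
          using l by (intro notI) simp
        moreover have "l \<noteq> 1"
          using l i by auto
        ultimately show ?thesis
          by simp
      next
        case False
        then have "coeff P i = 0 \<or> coeff (R ^ q) (?n - i) = 0"
          using coeff_power_CHAR[OF assms(1) q fix_q] by (metis coeff_eq_0 not_le)
        then show ?thesis
          by auto
      qed
    qed
  qed auto
  also have "\<dots> = coeff P (q - 1) * coeff R k"
    using q0 coeff_power_CHAR[OF assms(1) q fix_q, of "q * k"] by simp
  finally show ?thesis .
qed

text \<open>A lift to \<open>nat\<close> places the coefficients in the prime field and lets one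
  polynomial serve fields of different types.\<close>

definition nat_coeffs :: "'a::comm_semiring_1 poly \<Rightarrow> nat poly \<Rightarrow> bool" where
  "nat_coeffs P G \<longleftrightarrow> (\<forall>i. coeff P i = of_nat (coeff G i))"

lemma nat_coeffs_pCons:
  "nat_coeffs P G \<Longrightarrow> nat_coeffs (pCons (of_nat c) P) (pCons c G)"
  by (simp add: nat_coeffs_def coeff_pCons split: nat.split)

lemma nat_coeffs_0: "nat_coeffs 0 0"
  by (simp add: nat_coeffs_def)

lemma nat_coeffs_mult:
  "nat_coeffs P G \<Longrightarrow> nat_coeffs R H \<Longrightarrow> nat_coeffs (P * R) (G * H)"
  by (simp add: nat_coeffs_def coeff_mult)

lemma nat_coeffs_power: "nat_coeffs P G \<Longrightarrow> nat_coeffs (P ^ n) (G ^ n)"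
proof (induction n)
  case 0
  show ?case
    by (auto simp: nat_coeffs_def coeff_1)
qed (simp add: nat_coeffs_mult)

lemma of_nat_power_CHAR:
  fixes q :: nat
  assumes "prime CHAR('a::comm_ring_1)" and "q = CHAR('a) ^ e"
  shows "of_nat c ^ q = (of_nat c :: 'a)"
proof -
  have "[c ^ q = c] (mod CHAR('a))"
    unfolding assms(2)
  proof (induction e)
    case (Suc e)
    let ?p = "CHAR('a)"
    have "[c ^ ?p = c ^ 1] (mod ?p)"
      using assms(1) prime_gt_1_nat[OF assms(1)]
      by (intro power_cong_of_exponent_cong) (auto simp: cong_altdef_nat)
    moreover have "c ^ (?p ^ Suc e) = (c ^ (?p ^ e)) ^ ?p"
      by (simp add: power_mult[symmetric] mult.commute)
    ultimately show ?case
      using cong_pow[OF Suc.IH, of ?p] by (metis cong_trans power_one_right)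
  qed simp
  then show ?thesis
    by (metis of_nat_eq_iff_cong_CHAR of_nat_power)
qed

text \<open>Each of the \<open>n\<close> factors with exponent \<open>q ^ r\<close> equals the base
  itself, which lies in the prime field.\<close>

lemma of_nat_power_repunit:
  fixes q :: nat
  assumes "prime CHAR('a::comm_ring_1)" and "q = CHAR('a) ^ e"
  shows "of_nat c ^ (\<Sum>r<n. q ^ r) = (of_nat (c ^ n) :: 'a)"
proof (induction n)
  case (Suc n)
  have "of_nat c ^ (q ^ m) = (of_nat c :: 'a)" for m
    by (induction m) (simp_all add: power_mult of_nat_power_CHAR[OF assms])
  with Suc show ?case
    by (simp add: power_add mult.commute)
qed simp

text \<open>The induction splits off the lowest base-\<open>q\<close> digit. All \<open>n\<close>
  digits of \<open>q ^ n - 1\<close> are \<open>q - 1\<close>, and each contributes one factor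
  \<open>coeff P (q - 1)\<close>.\<close>

lemma coeff_power_repunit:
  fixes P :: "'a::comm_ring_1 poly"
  assumes "prime CHAR('a)" and q: "q = CHAR('a) ^ e" and G: "nat_coeffs P G"
    and deg: "degree P \<le> 2 * (q - 1)"
  shows "coeff (P ^ (\<Sum>r<n. q ^ r)) (q ^ n - 1) = coeff P (q - 1) ^ n"
proof (induction n)
  case (Suc n)
  have q0: "q > 0"
    using assms by (simp add: prime_gt_0_nat)
  let ?e = "\<Sum>r<n. q ^ r"
  have "(\<Sum>r<Suc n. q ^ r) = 1 + ?e * q"
    by (simp add: sum.lessThan_Suc_shift sum_distrib_left mult.commute del: sum.lessThan_Suc)
  then have "P ^ (\<Sum>r<Suc n. q ^ r) = P * (P ^ ?e) ^ q"
    by (simp add: power_mult)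
  moreover have "q * q ^ n > 0" "q ^ n > 0" "q \<le> q * q ^ n"
    using q0 by simp_all
  then have "q ^ Suc n - 1 = q - 1 + q * (q ^ n - 1)"
    using q0 by (simp add: diff_mult_distrib2)
  moreover have "coeff (P ^ ?e) i ^ q = coeff (P ^ ?e) i" for i
    using nat_coeffs_power[OF G, of ?e] of_nat_power_CHAR[OF assms(1) q]
    by (simp add: nat_coeffs_def)
  ultimately show ?case
    using coeff_mult_power_CHAR[OF assms(1) q _ deg, of "P ^ ?e" "q ^ n - 1"] Suc.IH by simp
qed simp

section \<open>Finite fields and primitive elements\<close>

lemma card_finite_field_ge_2: "CARD('a::finite_field) \<ge> 2"
proof -
  have "card {0, 1 :: 'a} \<le> CARD('a)"
    by (rule card_mono) auto
  then show ?thesis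
    by simp
qed

lemma CHAR_eq_of_card:
  assumes "prime p" and "CARD('a::finite_field) = p ^ n"
  shows "CHAR('a) = p"
proof -
  have "CHAR('a) dvd p"
    using CHAR_dvd_CARD[where 'a = 'a] prime_dvd_power[of "CHAR('a)" p n] assms(2) by simp
  then show ?thesis
    using assms(1) CHAR_prime primes_dvd_imp_eq by blast
qed

lemma finite_field_power_card_minus_1:
  fixes x :: "'a::finite_field"
  assumes "x \<noteq> 0"
  shows "x ^ (CARD('a) - 1) = 1"
proof -
  have "x * x ^ (CARD('a) - 1) = x * 1"
    using finite_field_power_card_eq_same[of x] card_finite_field_ge_2[where 'a = 'a]
    by (simp add: power_Suc[symmetric] del: power_Suc)
  then show ?thesis
    using assms by simp
qed

context
  fixes g :: "'a::finite_field"
  assumes prim: "primitive_element g"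
begin

lemma primitive_element_nonzero: "g \<noteq> 0"
proof
  assume "g = 0"
  have "g powi 1 \<in> mult_gen g"
    unfolding mult_gen_def by blast
  then show False
    using prim \<open>g = 0\<close> by (simp add: primitive_element_def)
qed

lemma powi_eq_power: obtains l where "g powi k = g ^ l"
proof
  define n where "n = CARD('a) - 1"
  have "n > 0"
    using card_finite_field_ge_2[where 'a = 'a] by (simp add: n_def)
  have "g powi k = g powi (int n * (k div int n) + k mod int n)"
    by simp
  also have "\<dots> = g powi (int n * (k div int n)) * g powi (k mod int n)"
    using primitive_element_nonzero by (intro power_int_add) simp
  also have "g powi (int n * (k div int n)) = (g powi int n) powi (k div int n)"
    by (rule power_int_mult)
  also have "g powi int n = 1"
    using finite_field_power_card_minus_1[OF primitive_element_nonzero]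
    by (simp only: n_def power_int_of_nat)
  also have "g powi (k mod int n) = g ^ nat (k mod int n)"
    using \<open>n > 0\<close> by (simp add: power_int_def)
  finally show "g powi k = g ^ nat (k mod int n)"
    by simp
qed

lemma nonzero_eq_power:
  assumes "x \<noteq> 0"
  obtains l where "x = g ^ l"
proof -
  have "x \<in> mult_gen g"
    using prim assms by (simp add: primitive_element_def)
  then show thesis
    using powi_eq_power that unfolding mult_gen_def by (metis rangeE)
qed

text \<open>A nonzero remainder \<open>d\<close> of \<open>l\<close> would give
  \<open>g ^ d = 1\<close>, leaving at most \<open>d\<close> powers of \<open>g\<close>, too few to
  cover the nonzero elements.\<close>

lemma primitive_power_eq_1_iff: "g ^ l = 1 \<longleftrightarrow> CARD('a) - 1 dvd l"
proof
  let ?n = "CARD('a) - 1"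
  have n: "g ^ ?n = 1"
    by (rule finite_field_power_card_minus_1[OF primitive_element_nonzero])
  show "?n dvd l \<Longrightarrow> g ^ l = 1"
    using n by (auto simp: power_mult)
  assume l: "g ^ l = 1"
  show "?n dvd l"
  proof (rule ccontr)
    assume "\<not> ?n dvd l"
    define d where "d = l mod ?n"
    have "d > 0" "d < ?n"
      using \<open>\<not> ?n dvd l\<close> card_finite_field_ge_2[where 'a = 'a] unfolding d_def
      by (auto simp: mod_greater_zero_iff_not_dvd)
    have "g ^ l = (g ^ ?n) ^ (l div ?n) * g ^ d"
      unfolding d_def by (simp add: power_mult[symmetric] power_add[symmetric])
    then have d: "g ^ d = 1"
      using l n by simp
    have "UNIV - {0} \<subseteq> (\<lambda>i. g ^ i) ` {..<d}"
    proof
      fix x assume "x \<in> UNIV - {0 :: 'a}"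
      then obtain k where "x = g ^ k"
        using nonzero_eq_power by auto
      also have "g ^ k = (g ^ d) ^ (k div d) * g ^ (k mod d)"
        by (simp add: power_mult[symmetric] power_add[symmetric])
      finally have "x = g ^ (k mod d)"
        using d by simp
      then show "x \<in> (\<lambda>i. g ^ i) ` {..<d}"
        using \<open>d > 0\<close> by auto
    qed
    then have "card (UNIV - {0 :: 'a}) \<le> card ((\<lambda>i. g ^ i) ` {..<d})"
      by (intro card_mono) auto
    also have "\<dots> \<le> d"
      using card_image_le[of "{..<d}" "\<lambda>i. g ^ i"] by simp
    finally show False
      using \<open>d < ?n\<close> by (simp add: card_Diff_singleton)
  qed
qed

text \<open>If \<open>CARD('a) - 1\<close> divides \<open>l\<close>, every nonzero element
  contributes \<open>1\<close>, and \<open>0\<close> does so only for \<open>l = 0\<close>.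
  Otherwise replacing \<open>x\<close> by \<open>g * x\<close> multiplies the sum by
  \<open>g ^ l\<close>, which is not \<open>1\<close>.\<close>

lemma sum_power_finite_field:
  "(\<Sum>x\<in>UNIV. x ^ l) = (if l > 0 \<and> CARD('a) - 1 dvd l then - 1 else (0 :: 'a))"
proof -
  have card_0: "of_nat CARD('a) = (0 :: 'a)"
    using CHAR_dvd_CARD[where 'a = 'a] by (simp add: of_nat_eq_0_iff_char_dvd)
  show ?thesis
  proof (cases "CARD('a) - 1 dvd l")
    case True
    have pow: "x ^ l = (if x = 0 \<and> l > 0 then 0 else 1)" for x :: 'a
      using True finite_field_power_card_minus_1[of x] by (auto simp: power_mult power_0_left)
    have "(\<Sum>x\<in>UNIV. (x :: 'a) ^ l) = (\<Sum>x\<in>UNIV. 1 - (if x = (0 :: 'a) \<and> l > 0 then 1 else 0))"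
      by (intro sum.cong refl) (simp add: pow)
    also have "\<dots> = of_nat CARD('a) - (if l > 0 then 1 else 0)"
      by (cases "l > 0") (simp_all add: sum_subtractf)
    finally show ?thesis
      using True card_0 by simp
  next
    case False
    have "(\<Sum>x\<in>UNIV. x ^ l) = (\<Sum>x\<in>UNIV. (g * x) ^ l)"
      by (rule sum.reindex_bij_witness[of _ "\<lambda>x. g * x" "\<lambda>x. x / g"])
        (use primitive_element_nonzero in auto)
    also have "\<dots> = g ^ l * (\<Sum>x\<in>UNIV. x ^ l)"
      by (simp add: power_mult_distrib sum_distrib_left)
    finally have "(1 - g ^ l) * (\<Sum>x\<in>UNIV. x ^ l) = 0"
      by (simp add: algebra_simps)
    then show ?thesis
      using False primitive_power_eq_1_iff[of l] by auto
  qed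
qed

text \<open>Only exponents that are positive multiples of \<open>CARD('a) - 1\<close> survive
  summation, and the degree bound leaves two of them.\<close>

lemma sum_poly_finite_field:
  fixes P :: "'a poly"
  assumes "degree P \<le> 2 * (CARD('a) - 1)"
  shows "(\<Sum>x\<in>UNIV. poly P x)
    = - coeff P (CARD('a) - 1) - coeff P (2 * (CARD('a) - 1))"
proof -
  let ?n = "CARD('a) - 1"
  have n0: "?n > 0"
    using card_finite_field_ge_2[where 'a = 'a] by simp
  have P: "poly P x = (\<Sum>i\<le>2 * ?n. coeff P i * x ^ i)" for x
    unfolding poly_altdef using assms by (intro sum.mono_neutral_left) (auto simp: coeff_eq_0)
  have dvd: "i > 0 \<and> ?n dvd i \<longleftrightarrow> i \<in> {?n, 2 * ?n}" if "i \<le> 2 * ?n" for i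
  proof
    assume "i > 0 \<and> ?n dvd i"
    then obtain c where c: "i = ?n * c" "c > 0"
      by auto
    then have "c \<le> 2"
      using that n0 by simp
    with c have "c = 1 \<or> c = 2"
      by auto
    with c show "i \<in> {?n, 2 * ?n}"
      by auto
  qed (use n0 in auto)
  have "(\<Sum>x\<in>UNIV. poly P x) = (\<Sum>i\<le>2 * ?n. coeff P i * (\<Sum>x\<in>UNIV. x ^ i))"
    unfolding P by (subst sum.swap) (simp add: sum_distrib_left)
  also have "\<dots> = (\<Sum>i\<le>2 * ?n. if i \<in> {?n, 2 * ?n} then - coeff P i else 0)"
    using dvd by (intro sum.cong) (auto simp: sum_power_finite_field)
  also have "\<dots> = (\<Sum>i\<in>{?n, 2 * ?n}. - coeff P i)"
    by (subst sum.inter_restrict[symmetric]) (auto intro: sum.cong)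
  finally show ?thesis
    using n0 by simp
qed

text \<open>As \<open>N\<close> divides the order of \<open>g\<close>, the discrete logarithm is
  well defined modulo \<open>N\<close>.\<close>

lemma power_in_cyclotomic_union_iff:
  assumes "N dvd CARD('a) - 1" and "I \<subseteq> {0..<N}"
  shows "g ^ l \<in> cyclotomic_union N I g \<longleftrightarrow> l mod N \<in> I"
proof
  assume "g ^ l \<in> cyclotomic_union N I g"
  then obtain i k where i: "i \<in> I" and "g ^ l = g ^ i * (g ^ N) powi k"
    unfolding cyclotomic_union_def mult_gen_def by blast
  moreover obtain c where "g powi k = g ^ c"
    by (rule powi_eq_power)
  then have "(g ^ N) powi k = g ^ (N * c)"
    by (metis mult.commute power_int_mult power_int_of_nat power_mult)
  ultimately have eq: "g ^ l = g ^ (i + N * c)"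
    by (simp add: power_add)
  have cong: "[a = b] (mod N)" if "g ^ a = g ^ b" "a \<le> b" for a b
  proof -
    have "g ^ (a + (b - a)) = g ^ a"
      using that by simp
    then have "g ^ a * g ^ (b - a) = g ^ a * 1"
      by (simp only: power_add mult_1_right)
    then have "g ^ (b - a) = 1"
      using primitive_element_nonzero by simp
    then have "N dvd b - a"
      using primitive_power_eq_1_iff assms(1) dvd_trans by blast
    then show ?thesis
      using that(2) by (metis cong_altdef_nat cong_sym)
  qed
  have "[l = i + N * c] (mod N)"
    using cong[OF eq] cong[OF eq[symmetric]] by (meson cong_sym nat_le_linear)
  then show "l mod N \<in> I"
    using i assms(2) by (auto simp: cong_def)
next
  assume "l mod N \<in> I"
  moreover have "g ^ l = g ^ (l mod N) * (g ^ N) powi int (l div N)"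
    by (simp add: power_mult[symmetric] power_add[symmetric])
  ultimately show "g ^ l \<in> cyclotomic_union N I g"
    unfolding cyclotomic_union_def mult_gen_def by blast
qed

lemma zero_notin_cyclotomic_union: "0 \<notin> cyclotomic_union N I g"
  using primitive_element_nonzero by (auto simp: cyclotomic_union_def mult_gen_def)

end

section \<open>Power sums over the punctured field\<close>

text \<open>Kept generic in the semiring, so that the version over \<open>nat\<close> gives the
  coefficients of all the others.\<close>

definition line_product :: "nat \<Rightarrow> nat \<Rightarrow> nat \<Rightarrow> nat \<Rightarrow> 'a::comm_semiring_1 poly" where
  "line_product b u v w = [:0, 1:] ^ u * [:1, 1:] ^ v * [:of_nat b, 1:] ^ w"

lemma poly_line_product: "poly (line_product b u v w) x = x ^ u * (x + 1) ^ v * (x + of_nat b) ^ w"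
  by (simp add: line_product_def add.commute)

lemma nat_coeffs_line_product: "nat_coeffs (line_product b u v w) (line_product b u v w)"
proof -
  have "nat_coeffs [:of_nat c, 1:] [:c, 1:]" for c
    using nat_coeffs_pCons[OF nat_coeffs_pCons[OF nat_coeffs_0, of 1], of c] by simp
  from this[of 0] this[of 1] this[of b] show ?thesis
    unfolding line_product_def by (intro nat_coeffs_mult nat_coeffs_power) simp_all
qed

lemma degree_line_product: "degree (line_product b u v w :: 'a::idom poly) = u + v + w"
  by (simp add: line_product_def degree_mult_eq degree_power_eq)

lemma lead_coeff_line_product:
  "coeff (line_product b u v w :: 'a::idom poly) (u + v + w) = 1"
proof -
  have "lead_coeff (line_product b u v w :: 'a poly) = 1"
    by (simp add: line_product_def lead_coeff_mult lead_coeff_power)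
  then show ?thesis
    by (simp add: degree_line_product)
qed

text \<open>The zeros of the three factors are left out because exponents may be reduced modulo the
  group order only at nonzero elements: \<open>0 ^ 0\<close> is \<open>1\<close>.\<close>

definition punctured_sum :: "nat \<Rightarrow> nat \<Rightarrow> nat \<Rightarrow> nat \<Rightarrow> 'a::finite_field" where
  "punctured_sum b u v w
    = (\<Sum>z\<in>UNIV - {0, - 1, - of_nat b}. z ^ u * (z + 1) ^ v * (z + of_nat b) ^ w)"

text \<open>The points \<open>0, - 1, - b\<close> are represented by the naturals \<open>0, p - 1, p - b\<close>.\<close>

definition sum_value :: "nat \<Rightarrow> nat \<Rightarrow> nat \<Rightarrow> nat \<Rightarrow> nat \<Rightarrow> nat \<Rightarrow> nat \<Rightarrow> nat \<Rightarrow> nat \<Rightarrow> int" where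
  "sum_value p q N M b n i j k =
    (let G = line_product b (i * M) (j * M) (k * M) :: nat poly in
      - int (coeff G (q - 1) ^ n) - of_bool (i + j + k = 2 * N)
      - int (\<Sum>c\<in>{0, p - 1, p - b}. poly G c ^ n))"

text \<open>The degree \<open>n\<close> occurs only as the exponent of natural numbers that do not
  depend on it.\<close>

lemma sum_value_cong:
  assumes "prime p" and "[s = t] (mod (p - 1))" and "s > 0" "t > 0"
  shows "[sum_value p q N M b s i j k = sum_value p q N M b t i j k] (mod int p)"
proof -
  have *: "[a ^ s = a ^ t] (mod p)" for a
    by (rule power_cong_of_exponent_cong[OF assms])
  show ?thesis
    unfolding sum_value_def Let_def
    by (intro cong_diff cong_refl cong_minus_minus_iff[THEN iffD2] cong_int_iff[THEN iffD2]
        cong_sum *)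
qed

section \<open>Evaluation and Frobenius invariance of the sums in one extension\<close>

locale cyclotomic_field =
  fixes p e q N M b n :: nat and g :: "'l::finite_field"
  assumes prime_p: "prime p" and q_eq: "q = p ^ e" and NM: "N * M = q - 1"
    and N_pos: "N > 0" and M_pos: "M > 0" and b: "1 < b" "b < p"
    and card_eq: "CARD('l) = q ^ n" and prim: "primitive_element g"
begin

text \<open>The exponent of the norm from the field of \<open>q ^ n\<close> elements to that of
  \<open>q\<close> elements.\<close>

definition "E = (\<Sum>r<n. q ^ r)"

lemma q_ge_2: "q \<ge> 2"
  using NM N_pos M_pos by (cases "q \<le> 1") auto

lemma CHAR_eq: "CHAR('l) = p"
  using card_eq by (intro CHAR_eq_of_card[OF prime_p, of "e * n"]) (simp add: q_eq power_mult)

lemma prime_CHAR: "prime CHAR('l)" and q_CHAR: "q = CHAR('l) ^ e"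
  by (simp_all add: CHAR_eq q_eq prime_p)

lemma card_minus_1: "CARD('l) - 1 = N * (M * E)"
  unfolding card_eq E_def using repunit_nat[OF q_ge_2, of n] by (simp only: NM mult.assoc[symmetric])

lemma E_pos: "E > 0"
  using card_minus_1 card_finite_field_ge_2[where 'a = 'l] by (cases "E = 0") auto

lemma power_mod_N:
  assumes "z \<noteq> (0 :: 'l)"
  shows "z ^ (i mod N * (M * E)) = z ^ (i * (M * E))"
proof -
  have "z ^ (i * (M * E)) = z ^ ((N * (i div N) + i mod N) * (M * E))"
    by simp
  also have "\<dots> = (z ^ (N * (M * E))) ^ (i div N) * z ^ (i mod N * (M * E))"
    by (simp only: power_add[symmetric] power_mult[symmetric] algebra_simps)
  also have "z ^ (N * (M * E)) = 1"
    using finite_field_power_card_minus_1[OF assms] card_minus_1 by simp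
  finally show ?thesis
    by simp
qed

text \<open>The summand is a value of \<open>P ^ E\<close>, whose degree is at most twice
  \<open>CARD('l) - 1\<close>. Its coefficient at \<open>q ^ n - 1\<close> is an \<open>n\<close>-th
  power; the one at twice that exponent is the leading \<open>1\<close> precisely if
  \<open>i + j + k = 2 * N\<close>.\<close>

lemma sum_line_product:
  assumes le: "i + j + k \<le> 2 * N"
  shows "(\<Sum>z\<in>UNIV. z ^ (i * (M * E)) * (z + 1) ^ (j * (M * E)) * (z + of_nat b) ^ (k * (M * E)))
    = (- of_nat (coeff (line_product b (i * M) (j * M) (k * M)) (q - 1) ^ n)
       - of_bool (i + j + k = 2 * N) :: 'l)"
proof -
  define P :: "'l poly" where "P = line_product b (i * M) (j * M) (k * M)"
  have deg: "degree P = (i + j + k) * M"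
    by (simp add: P_def degree_line_product algebra_simps)
  have "(i + j + k) * M \<le> 2 * N * M"
    using le by simp
  then have deg_le: "degree P \<le> 2 * (q - 1)"
    using deg NM by (simp add: mult.assoc)
  have deg_power: "degree (P ^ E) = (i + j + k) * (M * E)"
  proof -
    have "P \<noteq> 0"
      using lead_coeff_line_product[of b "i * M" "j * M" "k * M", where 'a = 'l]
      unfolding P_def by force
    then show ?thesis
      by (simp add: degree_power_eq deg mult_ac)
  qed
  have lead: "lead_coeff (P ^ E) = 1"
    using lead_coeff_line_product[of b "i * M" "j * M" "k * M", where 'a = 'l]
    by (simp add: lead_coeff_power degree_line_product P_def)
  have "(\<Sum>z\<in>UNIV. z ^ (i * (M * E)) * (z + 1) ^ (j * (M * E)) * (z + of_nat b) ^ (k * (M * E)))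
    = (\<Sum>z\<in>UNIV. poly (P ^ E) z)"
    by (simp add: P_def poly_line_product power_mult_distrib power_mult[symmetric] mult_ac)
  also have "\<dots> = - coeff (P ^ E) (CARD('l) - 1) - coeff (P ^ E) (2 * (CARD('l) - 1))"
    using mult_right_mono[OF le, of "M * E"]
    by (intro sum_poly_finite_field[OF prim]) (simp only: deg_power card_minus_1 mult.assoc)
  also have "coeff (P ^ E) (CARD('l) - 1) = coeff P (q - 1) ^ n"
    unfolding card_eq E_def P_def
    by (rule coeff_power_repunit[OF prime_CHAR q_CHAR nat_coeffs_line_product])
      (use deg_le in \<open>simp add: P_def\<close>)
  also have "coeff P (q - 1)
      = of_nat (coeff (line_product b (i * M) (j * M) (k * M)) (q - 1))"
    using nat_coeffs_line_product unfolding P_def nat_coeffs_def by blast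
  also have "coeff (P ^ E) (2 * (CARD('l) - 1)) = of_bool (i + j + k = 2 * N)"
  proof (cases "i + j + k = 2 * N")
    case True
    then have "2 * (CARD('l) - 1) = degree (P ^ E)"
      unfolding deg_power card_minus_1 by simp
    then show ?thesis
      using True lead by simp
  next
    case False
    then have "degree (P ^ E) < 2 * (CARD('l) - 1)"
      unfolding deg_power card_minus_1 using le M_pos E_pos
      by (simp add: mult.assoc[symmetric])
    then show ?thesis
      using False by (simp add: coeff_eq_0)
  qed
  finally show ?thesis
    by simp
qed

text \<open>The three missing points lie in the prime field, where raising to the power
  \<open>E\<close> amounts to raising to the power \<open>n\<close>.\<close>

lemma punctured_sum_eq:
  assumes "i + j + k \<le> 2 * N"
  shows "punctured_sum b (i * (M * E)) (j * (M * E)) (k * (M * E))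
    = (of_int (sum_value p q N M b n i j k) :: 'l)"
proof -
  let ?f = "\<lambda>z :: 'l. z ^ (i * (M * E)) * (z + 1) ^ (j * (M * E)) * (z + of_nat b) ^ (k * (M * E))"
  let ?G = "line_product b (i * M) (j * M) (k * M) :: nat poly"
  let ?X = "{0, - 1, - of_nat b} :: 'l set"
  have val: "?f (of_nat c) = of_nat (poly ?G c ^ n)" for c
  proof -
    have "?f (of_nat c) = of_nat (poly ?G c) ^ E"
      by (simp add: poly_line_product power_mult_distrib power_mult[symmetric] mult_ac add_ac)
    then show ?thesis
      unfolding E_def using of_nat_power_repunit[OF prime_CHAR q_CHAR] by simp
  qed
  have p_0: "of_nat p = (0 :: 'l)"
    using of_nat_CHAR[where 'a = 'l] by (simp add: CHAR_eq)
  have points: "?X = of_nat ` {0, p - 1, p - b}"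
    using b p_0 by (simp add: of_nat_diff)
  have "inj_on (of_nat :: nat \<Rightarrow> 'l) {..<p}"
    by (intro inj_onI) (simp add: of_nat_eq_iff_cong_CHAR CHAR_eq cong_less_modulus_unique_nat)
  then have inj: "inj_on (of_nat :: nat \<Rightarrow> 'l) {0, p - 1, p - b}"
    by (rule inj_on_subset) (use b in auto)
  have "punctured_sum b (i * (M * E)) (j * (M * E)) (k * (M * E)) = sum ?f UNIV - sum ?f ?X"
    unfolding punctured_sum_def by (rule sum_diff) auto
  also have "sum ?f ?X = (\<Sum>c\<in>{0, p - 1, p - b}. of_nat (poly ?G c ^ n))"
    unfolding points using inj by (simp only: sum.reindex o_def val)
  also have "sum ?f UNIV = - of_nat (coeff ?G (q - 1) ^ n) - of_bool (i + j + k = 2 * N)"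
    by (rule sum_line_product[OF assms])
  finally show ?thesis
    by (simp only: sum_value_def Let_def of_int_diff of_int_minus of_int_of_nat_eq of_nat_sum
        of_int_sum of_int_of_bool)
qed

text \<open>The map \<open>z \<mapsto> z ^ p\<close> is bijective, fixes the three omitted points
  and commutes with adding \<open>1\<close> and \<open>b\<close>, so it only multiplies the
  exponents by \<open>p\<close>.\<close>

lemma punctured_sum_Frobenius:
  "punctured_sum b (i * (M * E)) (j * (M * E)) (k * (M * E))
    = (punctured_sum b (p * i mod N * (M * E)) (p * j mod N * (M * E)) (p * k mod N * (M * E)) :: 'l)"
proof -
  let ?X = "{0, - 1, - of_nat b} :: 'l set"
  let ?f = "\<lambda>i j k. \<lambda>z :: 'l.
    z ^ (i * (M * E)) * (z + 1) ^ (j * (M * E)) * (z + of_nat b) ^ (k * (M * E))"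
  have fix_nat: "of_nat c ^ p = (of_nat c :: 'l)" for c
    using of_nat_power_CHAR[OF prime_CHAR, of p 1 c] by (simp add: CHAR_eq)
  have fix_neg: "(- of_nat c) ^ p = - (of_nat c :: 'l)" for c
    using minus_power_prime_CHAR[of p "of_nat c :: 'l"] prime_p by (simp add: CHAR_eq fix_nat)
  have add: "(x + y) ^ p = x ^ p + y ^ p" for x y :: 'l
    using freshmans_dream[OF prime_CHAR, of p x y] by (simp add: CHAR_eq)
  have inj: "inj (\<lambda>z :: 'l. z ^ p)"
  proof (rule injI)
    fix x y :: 'l assume "x ^ p = y ^ p"
    moreover have "(x - y) ^ p + y ^ p = x ^ p"
      by (simp add: add[symmetric])
    ultimately show "x = y"
      by simp
  qed
  have "(\<lambda>z. z ^ p) ` ?X = ?X"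
    using fix_neg[of 1] fix_neg[of b] prime_gt_0_nat[OF prime_p] by (simp add: zero_power)
  moreover have "(\<lambda>z :: 'l. z ^ p) ` UNIV = UNIV"
    using inj by (simp add: finite_UNIV_inj_surj)
  ultimately have image: "(\<lambda>z. z ^ p) ` (UNIV - ?X) = UNIV - ?X"
    using inj by (simp add: image_set_diff)
  have "sum (?f i j k) (UNIV - ?X) = sum (?f i j k) ((\<lambda>z. z ^ p) ` (UNIV - ?X))"
    by (simp only: image)
  also have "\<dots> = (\<Sum>z\<in>UNIV - ?X. ?f i j k (z ^ p))"
    using inj by (subst sum.reindex) (auto intro: inj_on_subset)
  also have "\<dots> = (\<Sum>z\<in>UNIV - ?X. ?f (p * i mod N) (p * j mod N) (p * k mod N) z)"
  proof (rule sum.cong)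
    fix z assume z: "z \<in> UNIV - ?X"
    have pow: "(x ^ p) ^ (i * (M * E)) = x ^ (p * i mod N * (M * E))" if "x \<noteq> 0" for x :: 'l and i
      using power_mod_N[OF that, of "p * i"] by (simp add: power_mult[symmetric] mult.assoc)
    have "z ^ p + 1 = (z + 1) ^ p" "z ^ p + of_nat b = (z + of_nat b) ^ p"
      by (simp_all add: add fix_nat)
    moreover have "z \<noteq> 0" "z + 1 \<noteq> 0" "z + of_nat b \<noteq> 0"
      using z by (auto simp: add_eq_0_iff2)
    ultimately show "?f i j k (z ^ p) = ?f (p * i mod N) (p * j mod N) (p * k mod N) z"
      by (simp only: pow not_False_eq_True)
  qed simp
  finally show ?thesis
    unfolding punctured_sum_def .
qed

lemma punctured_sum_rotate:
  assumes "i < N" "j < N" "k < N"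
  shows "punctured_sum b (i * (M * E)) (j * (M * E)) (k * (M * E))
    = (punctured_sum b (p ^ d * i mod N * (M * E)) (p ^ d * j mod N * (M * E))
        (p ^ d * k mod N * (M * E)) :: 'l)"
proof (induction d)
  case 0
  then show ?case
    using assms by simp
next
  case (Suc d)
  have "p * (p ^ d * x mod N) mod N = p ^ Suc d * x mod N" for x
    by (simp add: mod_mult_right_eq mult.assoc)
  then show ?case
    unfolding Suc by (subst punctured_sum_Frobenius) simp
qed

end

section \<open>Triple intersection numbers of lifts\<close>

lemma triple_intersection_eq_card:
  fixes S :: "'a::finite_field set"
  shows "triple_intersection x a S = card {y. y \<in> S \<and> y + x \<in> S \<and> y + a * x \<in> S}"
proof -
  have "y \<in> translate_by S c \<longleftrightarrow> y + c \<in> S" for y c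
    unfolding translate_by_def by (auto intro: image_eqI[of _ _ "y + c"])
  then have "S \<inter> translate_by S x \<inter> translate_by S (a * x)
      = {y. y \<in> S \<and> y + x \<in> S \<and> y + a * x \<in> S}"
    by auto
  then show ?thesis
    by (simp add: triple_intersection_def)
qed

text \<open>Substitute \<open>y = x * z\<close>. At each omitted point one of the three arguments is
  \<open>0\<close>, which is outside \<open>S\<close>.\<close>

lemma of_nat_triple_intersection:
  fixes S :: "'a::finite_field set"
  assumes "0 \<notin> S" and "x \<noteq> 0"
  shows "of_nat (triple_intersection x (of_nat b) S)
    = (\<Sum>z\<in>UNIV - {0, - 1, - of_nat b}. of_bool (x * z \<in> S) * of_bool (x * (z + 1) \<in> S)
        * of_bool (x * (z + of_nat b) \<in> S) :: 'a)"
proof -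
  let ?a = "of_nat b :: 'a"
  let ?f = "\<lambda>z. of_bool (x * z \<in> S) * of_bool (x * (z + 1) \<in> S) * of_bool (x * (z + ?a) \<in> S) :: 'a"
  have "of_nat (triple_intersection x ?a S)
      = (\<Sum>y\<in>UNIV. of_bool (y \<in> S \<and> y + x \<in> S \<and> y + ?a * x \<in> S) :: 'a)"
    by (simp add: triple_intersection_eq_card)
  also have "\<dots> = (\<Sum>z\<in>UNIV. ?f z)"
    by (rule sum.reindex_bij_witness[of _ "\<lambda>z. x * z" "\<lambda>y. y / x"])
      (use assms(2) in \<open>auto simp: distrib_left mult.commute\<close>)
  also have "\<dots> = (\<Sum>z\<in>UNIV - {0, - 1, - ?a}. ?f z)"
    using assms(1) by (intro sum.mono_neutral_right) auto
  finally show ?thesis .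
qed

text \<open>The discrete Fourier transform of the indicator of \<open>I\<close>;
  \<open>N - i\<close> stands for the exponent \<open>- i\<close>.\<close>

definition fourier_coeff :: "nat \<Rightarrow> nat set \<Rightarrow> 'k::field \<Rightarrow> nat \<Rightarrow> 'k" where
  "fourier_coeff N I \<zeta> j = (\<Sum>i\<in>I. \<zeta> ^ (j * (N - i))) / of_nat N"

text \<open>Fourier inversion: by the geometric series, the sum of \<open>\<zeta> ^ (j * c)\<close>
  over \<open>j < N\<close> vanishes unless \<open>N\<close> divides \<open>c\<close>.\<close>

lemma sum_fourier_coeff:
  fixes \<zeta> :: "'k::field"
  assumes N: "of_nat N \<noteq> (0 :: 'k)" and \<zeta>: "\<And>l. \<zeta> ^ l = 1 \<longleftrightarrow> N dvd l" and I: "I \<subseteq> {0..<N}"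
  shows "(\<Sum>j<N. fourier_coeff N I \<zeta> j * \<zeta> ^ (j * l)) = of_bool (l mod N \<in> I)"
proof -
  have fin: "finite I"
    using I finite_subset by blast
  have inner: "(\<Sum>j<N. \<zeta> ^ (j * c)) = (if N dvd c then of_nat N else 0)" for c
  proof (cases "N dvd c")
    case True
    then have "\<zeta> ^ (j * c) = 1" for j
      using \<zeta> by simp
    with True show ?thesis
      by simp
  next
    case False
    have "(\<zeta> ^ c - 1) * (\<Sum>j<N. (\<zeta> ^ c) ^ j) = (\<zeta> ^ c) ^ N - 1"
      by (rule power_diff_1_eq[symmetric])
    also have "(\<zeta> ^ c) ^ N = 1"
      using \<zeta>[of "c * N"] by (simp add: power_mult)
    finally show ?thesis
      using False \<zeta>[of c] by (simp add: power_mult[symmetric] mult.commute)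
  qed
  have dvd: "N dvd N - i + l \<longleftrightarrow> i = l mod N" if "i \<in> I" for i
  proof -
    have i: "i < N"
      using that I by auto
    have "N dvd N - i + l \<longleftrightarrow> [N - i + l = 0] (mod N)"
      by (simp add: cong_0_iff)
    also have "\<dots> \<longleftrightarrow> [N - i + l + i = 0 + i] (mod N)"
      by (simp only: cong_add_rcancel_nat)
    also have "N - i + l + i = l + N"
      using i by simp
    also have "[l + N = 0 + i] (mod N) \<longleftrightarrow> i = l mod N"
      using i by (auto simp: cong_def)
    finally show ?thesis .
  qed
  have "(\<Sum>j<N. fourier_coeff N I \<zeta> j * \<zeta> ^ (j * l))
      = (\<Sum>j<N. \<Sum>i\<in>I. \<zeta> ^ (j * (N - i + l))) / of_nat N"
    by (simp add: fourier_coeff_def sum_divide_distrib sum_distrib_right power_add distrib_left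
        divide_simps)
  also have "(\<Sum>j<N. \<Sum>i\<in>I. \<zeta> ^ (j * (N - i + l))) = (\<Sum>i\<in>I. \<Sum>j<N. \<zeta> ^ (j * (N - i + l)))"
    by (rule sum.swap)
  also have "\<dots> = (\<Sum>i\<in>I. if i = l mod N then of_nat N else 0)"
    using dvd by (intro sum.cong) (auto simp: inner)
  also have "\<dots> = of_nat N * of_bool (l mod N \<in> I)"
    using fin by simp
  finally show ?thesis
    using N by simp
qed

lemma sum_product_3:
  fixes f g h :: "_ \<Rightarrow> 'a::semiring_0"
  shows "sum f A * sum g B * sum h C = (\<Sum>i\<in>A. \<Sum>j\<in>B. \<Sum>k\<in>C. f i * g j * h k)"
  by (subst sum_product, simp only: sum_distrib_right, simp only: sum_distrib_left)

section \<open>Field embeddings\<close>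

lemma field_embedding_0: "field_embedding h \<Longrightarrow> h 0 = 0"
  unfolding field_embedding_def by (metis add_cancel_right_right)

lemma field_embedding_sum:
  assumes "field_embedding h"
  shows "h (sum f A) = (\<Sum>x\<in>A. h (f x))"
  using assms field_embedding_0[OF assms]
  by (induction A rule: infinite_finite_induct) (simp_all add: field_embedding_def)

lemma field_embedding_power:
  assumes "field_embedding h"
  shows "h (x ^ n) = h x ^ n"
  using assms by (induction n) (simp_all add: field_embedding_def)

lemma field_embedding_of_nat:
  assumes "field_embedding h"
  shows "h (of_nat n) = of_nat n"
  using assms field_embedding_0[OF assms] by (induction n) (simp_all add: field_embedding_def)

lemma field_embedding_of_int:
  assumes "field_embedding h"
  shows "h (of_int n) = of_int n"
proof -
  have minus: "h (- x) = - h x" for x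
    using assms field_embedding_0[OF assms] unfolding field_embedding_def
    by (metis add_eq_0_iff)
  show ?thesis
    by (cases n) (simp_all only: of_int_of_nat_eq of_int_minus minus field_embedding_of_nat[OF assms])
qed

lemma field_embedding_eq_0_iff:
  assumes "field_embedding h"
  shows "h x = 0 \<longleftrightarrow> x = 0"
  using assms field_embedding_0[OF assms] unfolding field_embedding_def
  by (metis mult_zero_left right_inverse zero_neq_one)

lemma inj_field_embedding:
  assumes "field_embedding h"
  shows "inj h"
proof (rule injI)
  fix x y assume "h x = h y"
  moreover have "h x = h (x - y) + h y"
    using assms unfolding field_embedding_def by (metis diff_add_cancel)
  ultimately show "x = y"
    using field_embedding_eq_0_iff[OF assms, of "x - y"] by simp
qed

section \<open>Fourier expansion of triple intersection numbers of a lift\<close>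

locale cyclotomic_lift = cyclotomic_field p e q N M b n g
  for p e q N M b n and g :: "'l::finite_field" +
  fixes \<omega> :: "'k::finite_field" and \<iota> :: "'k \<Rightarrow> 'l" and I :: "nat set"
  assumes emb: "field_embedding \<iota>" and lift: "g ^ E = \<iota> \<omega>"
    and card_base: "CARD('k) = q" and I_subset: "I \<subseteq> {0..<N}"
begin

text \<open>The image of \<open>\<omega> ^ M\<close> is \<open>g ^ (M * E)\<close>, and
  \<open>g\<close> has order \<open>N * (M * E)\<close>.\<close>

lemma base_power_eq_1_iff: "(\<omega> ^ M) ^ l = 1 \<longleftrightarrow> N dvd l"
proof -
  have "(\<omega> ^ M) ^ l = 1 \<longleftrightarrow> \<iota> ((\<omega> ^ M) ^ l) = \<iota> 1"
    using inj_field_embedding[OF emb] by (simp add: inj_eq)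
  also have "\<dots> \<longleftrightarrow> g ^ (l * (M * E)) = 1"
    using emb by (simp add: field_embedding_power[OF emb] lift[symmetric] power_mult[symmetric]
        mult_ac field_embedding_def)
  also have "\<dots> \<longleftrightarrow> N * (M * E) dvd l * (M * E)"
    by (simp only: primitive_power_eq_1_iff[OF prim] card_minus_1)
  also have "\<dots> \<longleftrightarrow> N dvd l"
    using M_pos E_pos by simp
  finally show ?thesis .
qed

lemma CHAR_base: "CHAR('k) = p"
  using card_base by (intro CHAR_eq_of_card[OF prime_p, of e]) (simp add: q_eq)

lemma of_nat_N_nonzero: "of_nat N \<noteq> (0 :: 'k)"
proof
  assume "of_nat N = (0 :: 'k)"
  then have "p dvd N"
    by (simp add: of_nat_eq_0_iff_char_dvd CHAR_base)
  then have "p dvd q - 1"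
    by (metis NM dvd_mult2)
  moreover have "p dvd q"
    using CHAR_dvd_CARD[where 'a = 'k] by (simp add: CHAR_base card_base)
  ultimately have "p dvd 1"
    using q_ge_2 by (metis dvd_diffD1 less_imp_le_nat less_le_trans one_less_numeral_iff semiring_norm(76))
  then show False
    using prime_p by auto
qed

text \<open>For \<open>w = g ^ l\<close>, the power \<open>w ^ (M * E)\<close> is the image of
  \<open>(\<omega> ^ M) ^ l\<close>, so Fourier inversion in the base field carries over along
  \<open>\<iota>\<close>.\<close>

lemma indicator_eq:
  assumes "w \<noteq> 0"
  shows "of_bool (w \<in> cyclotomic_union N I g)
    = (\<Sum>j<N. \<iota> (fourier_coeff N I (\<omega> ^ M) j) * w ^ (j * (M * E)))"
proof -
  obtain l where l: "w = g ^ l"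
    by (rule nonzero_eq_power[OF prim assms])
  have "w ^ (j * (M * E)) = \<iota> ((\<omega> ^ M) ^ (j * l))" for j
    by (simp add: l field_embedding_power[OF emb] lift[symmetric] power_mult[symmetric] mult_ac)
  then have "(\<Sum>j<N. \<iota> (fourier_coeff N I (\<omega> ^ M) j) * w ^ (j * (M * E)))
      = \<iota> (\<Sum>j<N. fourier_coeff N I (\<omega> ^ M) j * (\<omega> ^ M) ^ (j * l))"
    using emb by (simp add: field_embedding_sum[OF emb] field_embedding_def)
  also have "(\<Sum>j<N. fourier_coeff N I (\<omega> ^ M) j * (\<omega> ^ M) ^ (j * l)) = of_bool (l mod N \<in> I)"
    by (rule sum_fourier_coeff[OF of_nat_N_nonzero base_power_eq_1_iff I_subset])
  also have "l mod N \<in> I \<longleftrightarrow> w \<in> cyclotomic_union N I g"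
  proof -
    have "N dvd CARD('l) - 1"
      unfolding card_minus_1 by simp
    then show ?thesis
      using power_in_cyclotomic_union_iff[OF prim _ I_subset, of l] by (simp add: l)
  qed
  also have "\<iota> (of_bool (w \<in> cyclotomic_union N I g)) = of_bool (w \<in> cyclotomic_union N I g)"
    using emb field_embedding_0[OF emb] by (simp add: field_embedding_def)
  finally show ?thesis
    by simp
qed

text \<open>Multiplying out the three indicators leaves punctured sums. The argument of
  \<open>\<iota>\<close> then involves only base field data and \<open>W\<close>, so lifts sharing
  \<open>W\<close> share this value.\<close>

lemma triple_intersection_eq:
  assumes W: "\<And>i j k. i < N \<Longrightarrow> j < N \<Longrightarrow> k < N \<Longrightarrow>
    punctured_sum b (i * (M * E)) (j * (M * E)) (k * (M * E)) = (of_int (W i j k) :: 'l)"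
  shows "of_nat (triple_intersection (g ^ l) (of_nat b) (cyclotomic_union N I g))
    = \<iota> (\<Sum>i<N. \<Sum>j<N. \<Sum>k<N. fourier_coeff N I (\<omega> ^ M) i * fourier_coeff N I (\<omega> ^ M) j
        * fourier_coeff N I (\<omega> ^ M) k * (\<omega> ^ M) ^ ((i + j + k) * l) * of_int (W i j k))"
proof -
  let ?c = "fourier_coeff N I (\<omega> ^ M)"
  let ?S = "cyclotomic_union N I g"
  let ?Z = "UNIV - {0, - 1, - of_nat b} :: 'l set"
  let ?m = "\<lambda>i j k z :: 'l. z ^ (i * (M * E)) * (z + 1) ^ (j * (M * E)) * (z + of_nat b) ^ (k * (M * E))"
  have g0: "g \<noteq> 0"
    by (rule primitive_element_nonzero[OF prim])
  have mult: "\<iota> (x * y) = \<iota> x * \<iota> y" for x y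
    using emb by (simp add: field_embedding_def)
  have expand: "of_bool (g ^ l * z \<in> ?S) * of_bool (g ^ l * (z + 1) \<in> ?S)
        * of_bool (g ^ l * (z + of_nat b) \<in> ?S)
      = (\<Sum>i<N. \<Sum>j<N. \<Sum>k<N. \<iota> (?c i * ?c j * ?c k * (\<omega> ^ M) ^ ((i + j + k) * l)) * ?m i j k z)"
    if z: "z \<in> ?Z" for z
  proof -
    have "z \<noteq> 0" "z + 1 \<noteq> 0" "z + of_nat b \<noteq> 0"
      using z by (auto simp: add_eq_0_iff2)
    then have "g ^ l * z \<noteq> 0" "g ^ l * (z + 1) \<noteq> 0" "g ^ l * (z + of_nat b) \<noteq> 0"
      using g0 by simp_all
    note ind = this[THEN indicator_eq]
    have pow: "(g ^ l) ^ (i * (M * E)) = \<iota> ((\<omega> ^ M) ^ (i * l))" for i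
      by (simp add: field_embedding_power[OF emb] lift[symmetric] power_mult[symmetric] mult_ac)
    have "\<iota> (?c i) * (g ^ l * z) ^ (i * (M * E)) * (\<iota> (?c j) * (g ^ l * (z + 1)) ^ (j * (M * E)))
        * (\<iota> (?c k) * (g ^ l * (z + of_nat b)) ^ (k * (M * E)))
      = \<iota> (?c i * ?c j * ?c k * (\<omega> ^ M) ^ ((i + j + k) * l)) * ?m i j k z" for i j k
    proof -
      have "(\<omega> ^ M) ^ ((i + j + k) * l) = (\<omega> ^ M) ^ (i * l) * (\<omega> ^ M) ^ (j * l) * (\<omega> ^ M) ^ (k * l)"
        by (simp only: power_add distrib_right)
      then show ?thesis
        by (simp only: power_mult_distrib pow mult) (simp only: mult_ac)
    qed
    then show ?thesis
      unfolding ind by (simp only: sum_product_3)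
  qed
  have "of_nat (triple_intersection (g ^ l) (of_nat b) ?S)
      = (\<Sum>z\<in>?Z. of_bool (g ^ l * z \<in> ?S) * of_bool (g ^ l * (z + 1) \<in> ?S)
        * of_bool (g ^ l * (z + of_nat b) \<in> ?S) :: 'l)"
    using zero_notin_cyclotomic_union[OF prim] g0 by (intro of_nat_triple_intersection) auto
  also have "\<dots> = (\<Sum>z\<in>?Z. \<Sum>i<N. \<Sum>j<N. \<Sum>k<N.
          \<iota> (?c i * ?c j * ?c k * (\<omega> ^ M) ^ ((i + j + k) * l)) * ?m i j k z)"
    by (intro sum.cong refl expand)
  also have "\<dots> = (\<Sum>i<N. \<Sum>z\<in>?Z. \<Sum>j<N. \<Sum>k<N.
          \<iota> (?c i * ?c j * ?c k * (\<omega> ^ M) ^ ((i + j + k) * l)) * ?m i j k z)"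
    by (rule sum.swap)
  also have "\<dots> = (\<Sum>i<N. \<Sum>j<N. \<Sum>z\<in>?Z. \<Sum>k<N.
          \<iota> (?c i * ?c j * ?c k * (\<omega> ^ M) ^ ((i + j + k) * l)) * ?m i j k z)"
    by (intro sum.cong refl sum.swap)
  also have "\<dots> = (\<Sum>i<N. \<Sum>j<N. \<Sum>k<N. \<Sum>z\<in>?Z.
          \<iota> (?c i * ?c j * ?c k * (\<omega> ^ M) ^ ((i + j + k) * l)) * ?m i j k z)"
    by (intro sum.cong refl sum.swap)
  also have "\<dots> = (\<Sum>i<N. \<Sum>j<N. \<Sum>k<N.
          \<iota> (?c i * ?c j * ?c k * (\<omega> ^ M) ^ ((i + j + k) * l)) * \<iota> (of_int (W i j k)))"
    by (intro sum.cong refl)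
      (simp add: sum_distrib_left[symmetric] punctured_sum_def[symmetric] W field_embedding_of_int[OF emb])
  finally show ?thesis
    by (simp only: field_embedding_sum[OF emb] mult)
qed

end

section \<open>Comparison of the two lifts for each exponent\<close>

theorem theorem3p5:
  fixes p1 m N p f s q t t' k u :: nat
    and I :: "nat set"
    and \<omega> a :: "'k::finite_field"
    and \<gamma> :: "'l::finite_field"
    and \<beta> :: "'m::finite_field"
    and \<iota>' :: "'k \<Rightarrow> 'l" and \<iota>'' :: "'k \<Rightarrow> 'm"
    and D :: "'k set" and D' :: "'l set" and D'' :: "'m set"
  assumes "prime p1" and "[p1 = 7] (mod 8)" and "m \<ge> 1" and "N = 2 * p1 ^ m"
    and "prime p" and "[p = 3] (mod 4)"
    and "f = ord N p" and "2 * f = totient N"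
    and "odd s" and "q = p ^ (f * s)"
    and "I \<subseteq> {0..<N}" and "(\<lambda>i. i mod p1 ^ m) ` I = {0..<p1 ^ m}"
    and "odd t"
    and "t' = (digit_sum p ^^ k) t" and "odd t'" and "1 \<le> t'" and "t' \<le> p - 2"
    and "CARD('k) = q" and "CARD('l) = q ^ t" and "CARD('m) = q ^ t'"
    and "field_embedding \<iota>'" and "field_embedding \<iota>''"
    and "primitive_element \<gamma>" and "primitive_element \<beta>"
    and "\<gamma> ^ ((q ^ t - 1) div (q - 1)) = \<iota>' \<omega>"
    and "\<beta> ^ ((q ^ t' - 1) div (q - 1)) = \<iota>'' \<omega>"
    and "D = cyclotomic_union N I \<omega>"
    and "D' = cyclotomic_union N I \<gamma>"
    and "D'' = cyclotomic_union N I \<beta>"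
    and "a \<in> range of_nat - {0, 1}"
    and "card ((\<lambda>l. triple_intersection (\<beta> ^ l) (\<iota>'' a) D'' mod p) ` {0..N - 1}) = u"
  shows "card ((\<lambda>l. triple_intersection (\<gamma> ^ l) (\<iota>' a) D' mod p) ` {0..N - 1}) = u"
proof -
  define M where "M = (q - 1) div N"
  interpret R: index_two_residues p1 m N p f
    by unfold_locales (use assms(1-4,7,8) in blast)+
  have p1: "p > 1"
    using \<open>prime p\<close> by (rule prime_gt_1_nat)
  have s_pos: "s > 0" and t_pos: "t > 0" and t'_pos: "t' > 0"
    using \<open>odd s\<close> \<open>odd t\<close> \<open>odd t'\<close> by (auto intro: odd_pos)
  have q_ge_2: "q \<ge> 2"
  proof -
    have "p ^ 1 \<le> p ^ (f * s)"
      using p1 R.f_pos s_pos by (intro power_increasing) auto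
    then show ?thesis
      using p1 \<open>q = p ^ (f * s)\<close> by simp
  qed
  have "[(p ^ f) ^ s = 1 ^ s] (mod N)"
    by (rule cong_pow[OF R.power_f])
  then have "[q = 1] (mod N)"
    using \<open>q = p ^ (f * s)\<close> by (simp add: power_mult)
  then have "N dvd q - 1"
    using q_ge_2 by (simp add: cong_altdef_nat)
  then have NM: "N * M = q - 1"
    by (simp add: M_def)
  have N_pos: "N > 0"
    using R.N_gt_2 by simp
  have M_pos: "M > 0"
    using NM q_ge_2 by (cases "M = 0") auto
  have CHAR_k: "CHAR('k) = p"
    using assms(5,10,18) by (intro CHAR_eq_of_card[of p "f * s"]) simp_all
  obtain b0 where b0: "a = of_nat b0" "a \<noteq> 0" "a \<noteq> 1"
    using \<open>a \<in> range of_nat - {0, 1}\<close> by auto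
  \<comment> \<open>The reduced representative satisfies \<open>1 < b < p\<close>, since
    \<open>a\<close> is neither \<open>0\<close> nor \<open>1\<close>.\<close>
  define b where "b = b0 mod p"
  have a_eq: "a = of_nat b"
    unfolding b0(1) b_def of_nat_eq_iff_cong_CHAR CHAR_k by (simp add: cong_def)
  have b: "1 < b" "b < p"
  proof -
    have "b \<noteq> 0" "b \<noteq> 1"
      using b0(2,3) unfolding a_eq by (metis of_nat_0, metis of_nat_1)
    then show "1 < b"
      by simp
    show "b < p"
      unfolding b_def using p1 by simp
  qed
  interpret L: cyclotomic_field p "f * s" q N M b t \<gamma>
    using assms(5,10,19,23) NM N_pos M_pos b by unfold_locales
  interpret L: cyclotomic_lift p "f * s" q N M b t \<gamma> \<omega> \<iota>' I
  proof unfold_locales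
    have "(q ^ t - 1) div (q - 1) = L.E"
      unfolding L.E_def repunit_nat[OF q_ge_2, symmetric] using q_ge_2 by simp
    then show "\<gamma> ^ L.E = \<iota>' \<omega>"
      using assms(25) by simp
  qed (use assms(11,18,21) in simp_all)
  interpret B: cyclotomic_field p "f * s" q N M b t' \<beta>
    using assms(5,10,20,24) NM N_pos M_pos b by unfold_locales
  interpret B: cyclotomic_lift p "f * s" q N M b t' \<beta> \<omega> \<iota>'' I
  proof unfold_locales
    have "(q ^ t' - 1) div (q - 1) = B.E"
      unfolding B.E_def repunit_nat[OF q_ge_2, symmetric] using q_ge_2 by simp
    then show "\<beta> ^ B.E = \<iota>'' \<omega>"
      using assms(26) by simp
  qed (use assms(11,18,22) in simp_all)
  \<comment> \<open>This congruence is the link between the two extension degrees.\<close>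
  have t_cong: "[t = t'] (mod (p - 1))"
    unfolding \<open>t' = (digit_sum p ^^ k) t\<close> using p1
    by (intro cong_sym[OF digit_sum_funpow_cong]) simp
  have "\<exists>w. punctured_sum b (i * (M * L.E)) (j * (M * L.E)) (h * (M * L.E)) = (of_int w :: 'l)
      \<and> punctured_sum b (i * (M * B.E)) (j * (M * B.E)) (h * (M * B.E)) = (of_int w :: 'm)"
    if ijh: "i < N" "j < N" "h < N" for i j h
  proof -
    \<comment> \<open>The rotation depends on the exponents alone, so one \<open>d\<close> serves
      both extensions.\<close>
    obtain d where d: "p ^ d * i mod N + p ^ d * j mod N + p ^ d * h mod N \<le> 2 * N"
      by (rule R.exists_small_rotation[OF ijh])
    let ?w = "\<lambda>n. sum_value p q N M b n (p ^ d * i mod N) (p ^ d * j mod N) (p ^ d * h mod N)"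
    have "of_int (?w t) = (of_int (?w t') :: 'm)"
      using sum_value_cong[OF \<open>prime p\<close> t_cong t_pos t'_pos]
      by (simp add: of_int_eq_iff_cong_CHAR B.CHAR_eq)
    then show ?thesis
      using L.punctured_sum_rotate[OF ijh, of d] L.punctured_sum_eq[OF d]
        B.punctured_sum_rotate[OF ijh, of d] B.punctured_sum_eq[OF d]
      by (intro exI[of _ "?w t"]) simp
  qed
  then obtain W where W: "\<And>i j h. i < N \<Longrightarrow> j < N \<Longrightarrow> h < N \<Longrightarrow>
      punctured_sum b (i * (M * L.E)) (j * (M * L.E)) (h * (M * L.E)) = (of_int (W i j h) :: 'l)
      \<and> punctured_sum b (i * (M * B.E)) (j * (M * B.E)) (h * (M * B.E)) = (of_int (W i j h) :: 'm)"
    by metis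
  have "triple_intersection (\<gamma> ^ l) (\<iota>' a) D' mod p
      = triple_intersection (\<beta> ^ l) (\<iota>'' a) D'' mod p" for l
  proof -
    let ?x = "triple_intersection (\<gamma> ^ l) (\<iota>' a) D'"
    let ?y = "triple_intersection (\<beta> ^ l) (\<iota>'' a) D''"
    let ?c = "fourier_coeff N I (\<omega> ^ M)"
    define v where "v = (\<Sum>i<N. \<Sum>j<N. \<Sum>h<N. ?c i * ?c j * ?c h
      * (\<omega> ^ M) ^ ((i + j + h) * l) * of_int (W i j h))"
    have "\<iota>' (of_nat ?x) = \<iota>' v"
      unfolding v_def \<open>D' = cyclotomic_union N I \<gamma>\<close> a_eq field_embedding_of_nat[OF L.emb]
      by (rule L.triple_intersection_eq) (use W in blast)
    moreover have "\<iota>'' (of_nat ?y) = \<iota>'' v"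
      unfolding v_def \<open>D'' = cyclotomic_union N I \<beta>\<close> a_eq field_embedding_of_nat[OF B.emb]
      by (rule B.triple_intersection_eq) (use W in blast)
    \<comment> \<open>Injectivity of the embeddings brings both counts back to \<open>v\<close> in
      the base field, where equality means congruence modulo \<open>p\<close>.\<close>
    ultimately have "of_nat ?x = (of_nat ?y :: 'k)"
      using inj_field_embedding[OF L.emb] inj_field_embedding[OF B.emb] by (simp add: inj_eq)
    then show ?thesis
      unfolding of_nat_eq_iff_cong_CHAR CHAR_k cong_def .
  qed
  then show ?thesis
    using \<open>card ((\<lambda>l. triple_intersection (\<beta> ^ l) (\<iota>'' a) D'' mod p) ` {0..N - 1}) = u\<close> by simp
qed

end
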